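(* Let $N=2^n$ and $P\ge 4$ be powers of $2$, let $F:\{0,\ldots,N-1\}\to\{0,1\}$ be a Boolean function with $t=|F^{-1}(1)|\le N/2$, and let $\tilde t$ be the (random) output of the quantum algorithm $\mathbf{Count}(F,P)$ described in the context. Then $$|t-\tilde t| < \frac{2\pi}{P}\sqrt{tN}+\frac{\pi^2}{P^2}N$$ with probability at least $8/\pi^2$.
   Context: Notation. For $n$ qubits, $\mathbf W$ is the Walsh--Hadamard transform (the $n$-fold tensor power of the Hadamard gate), so $\mathbf W|0\rangle = 2^{-n/2}\sum_{i=0}^{2^n-1}|i\rangle$. For $F:\{0,\dots,N-1\}\to\{0,1\}$ with $N=2^n$, let $\mathbf S_F$ be the unitary on $\mathbb C^N$ with $\mathbf S_F|x\rangle = (-1)^{F(x)}|x\rangle$, let $\mathbf S_0$ be the unitary with $\mathbf S_0|0\rangle=-|0\rangle$ and $\mathbf S_0|x\rangle=|x\rangle$ for $x\neq 0$, and let the Grover iteration be $\mathbf G_F = -\mathbf W\,\mathbf S_0\,\mathbf W^{-1}\,\mathbf S_F$. On $\mathbb C^P\otimes\mathbb C^N$ define the unitary $\mathbf C_F: |m\rangle\otimes|\Psi\rangle\mapsto |m\rangle\otimes(\mathbf G_F)^m|\Psi\rangle$ for $0\le m\le P-1$. The quantum Fourier transform on $\mathbb C^P$ is $\mathbf F_P:|k\rangle\mapsto \frac1{\sqrt P}\sum_{l=0}^{P-1}e^{2\pi \mathrm{i} kl/P}|l\rangle$. Algorithm $\mathbf{Count}(F,P)$: 1. $|\Psi_0\rangle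 \leftarrow (\mathbf W\otimes\mathbf W)|0\rangle|0\rangle$ (first register $\mathbb C^P$, i.e. $\log_2P$ qubits; second register $\mathbb C^N$, i.e. $n$ qubits). 2. $|\Psi_1\rangle\leftarrow\mathbf C_F|\Psi_0\rangle$. 3. (Optional; it does not affect the distribution of the output.) $|\Psi_2\rangle\leftarrow$ the state $|\Psi_1\rangle$ after the second register is measured in the computational basis; if the step is skipped, $|\Psi_2\rangle=|\Psi_1\rangle$. 4. $|\Psi_3\rangle\leftarrow(\mathbf F_P\otimes\mathbf I)|\Psi_2\rangle$. 5. $\tilde f\leftarrow$ the outcome of measuring the first register of $|\Psi_3\rangle$ in the computational basis; if $\tilde f>P/2$ then replace $\tilde f$ by $P-\tilde f$. 6. Output $\tilde t = N\sin^2(\tilde f\pi/P)$. *)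

theory Defs
  imports
    "HOL-Probability.Probability_Mass_Function"
    "Jordan_Normal_Form.Gauss_Jordan_Elimination"
begin

(* These symbols would otherwise be ambiguous with those of Jordan_Normal_Form. *)
no_notation Finite_Cartesian_Product.vec_nth (infixl \<open>$\<close> 90)

text \<open>The space \<open>\<complex>\<^sup>P \<otimes> \<complex>\<^sup>N\<close> is identified with \<open>\<complex>\<^sup>P\<^sup>N\<close>:
  the basis vector \<open>|m\<rangle> \<otimes> |x\<rangle>\<close> is the unit vector with index \<open>m * N + x\<close>.\<close>

definition kron_mat :: "complex mat \<Rightarrow> complex mat \<Rightarrow> complex mat" where
  "kron_mat A B = mat (dim_row A * dim_row B) (dim_col A * dim_col B)
     (\<lambda>(i, j). A $$ (i div dim_row B, j div dim_col B) * B $$ (i mod dim_row B, j mod dim_col B))"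

definition kron_vec :: "complex Matrix.vec \<Rightarrow> complex Matrix.vec \<Rightarrow> complex Matrix.vec" where
  "kron_vec u v = Matrix.vec (dim_vec u * dim_vec v)
     (\<lambda>i. u $ (i div dim_vec v) * v $ (i mod dim_vec v))"

definition hadamard_gate :: "complex mat" where
  "hadamard_gate = mat_of_rows_list 2
     [[1 / complex_of_real (sqrt 2),   1 / complex_of_real (sqrt 2)],
      [1 / complex_of_real (sqrt 2), - 1 / complex_of_real (sqrt 2)]]"

fun walsh_hadamard :: "nat \<Rightarrow> complex mat" where
  "walsh_hadamard 0 = 1\<^sub>m 1"
| "walsh_hadamard (Suc n) = kron_mat hadamard_gate (walsh_hadamard n)"

definition phase_oracle :: "nat \<Rightarrow> (nat \<Rightarrow> nat) \<Rightarrow> complex mat" where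
  "phase_oracle N F = mat N N (\<lambda>(i, j). if i = j then (- 1) ^ F j else 0)"

definition zero_reflection :: "nat \<Rightarrow> complex mat" where
  "zero_reflection N = mat N N (\<lambda>(i, j). if i = j then (if j = 0 then - 1 else 1) else 0)"

definition grover_iteration :: "nat \<Rightarrow> (nat \<Rightarrow> nat) \<Rightarrow> complex mat" where
  "grover_iteration n F =
     - (walsh_hadamard n * zero_reflection (2 ^ n) * the (mat_inverse (walsh_hadamard n))
        * phase_oracle (2 ^ n) F)"

text \<open>The block-diagonal operator \<open>|m\<rangle> \<otimes> |\<Psi>\<rangle> \<mapsto> |m\<rangle> \<otimes> G\<^sup>m |\<Psi>\<rangle>\<close>, for \<open>m < P\<close>
  and \<open>G\<close> of size \<open>N \<times> N\<close>; see \<open>controlled_power_kron_vec\<close> below.\<close>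

definition controlled_power :: "nat \<Rightarrow> nat \<Rightarrow> complex mat \<Rightarrow> complex mat" where
  "controlled_power P N G = mat (P * N) (P * N)
     (\<lambda>(i, j). if i div N = j div N then (G ^\<^sub>m (j div N)) $$ (i mod N, j mod N) else 0)"

definition qft :: "nat \<Rightarrow> complex mat" where
  "qft P = mat P P (\<lambda>(l, k).
     exp (2 * complex_of_real pi * \<i> * of_nat k * of_nat l / of_nat P) / complex_of_real (sqrt (real P)))"

text \<open>Measurements in the computational basis of one register of a state in
  \<open>\<complex>\<^sup>P \<otimes> \<complex>\<^sup>N\<close>. The weights form a probability distribution, as \<open>embed_pmf\<close> requires,
  when the state has norm \<open>1\<close>; see \<open>pmf_measure_fst\<close> and \<open>pmf_outcome_snd\<close> below.\<close>

definition prob_fst :: "nat \<Rightarrow> nat \<Rightarrow> complex Matrix.vec \<Rightarrow> nat \<Rightarrow> real" where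
  "prob_fst P N \<psi> m = (if m < P then \<Sum>x<N. (cmod (\<psi> $ (m * N + x)))\<^sup>2 else 0)"

definition measure_fst :: "nat \<Rightarrow> nat \<Rightarrow> complex Matrix.vec \<Rightarrow> nat pmf" where
  "measure_fst P N \<psi> = embed_pmf (prob_fst P N \<psi>)"

definition prob_snd :: "nat \<Rightarrow> nat \<Rightarrow> complex Matrix.vec \<Rightarrow> nat \<Rightarrow> real" where
  "prob_snd P N \<psi> x = (if x < N then \<Sum>m<P. (cmod (\<psi> $ (m * N + x)))\<^sup>2 else 0)"

definition outcome_snd :: "nat \<Rightarrow> nat \<Rightarrow> complex Matrix.vec \<Rightarrow> nat pmf" where
  "outcome_snd P N \<psi> = embed_pmf (prob_snd P N \<psi>)"

definition collapse_snd ::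
    "nat \<Rightarrow> nat \<Rightarrow> complex Matrix.vec \<Rightarrow> nat \<Rightarrow> complex Matrix.vec" where
  "collapse_snd P N \<psi> x = Matrix.vec (P * N)
     (\<lambda>i. if i mod N = x then \<psi> $ i / complex_of_real (sqrt (prob_snd P N \<psi> x)) else 0)"

definition measure_snd :: "nat \<Rightarrow> nat \<Rightarrow> complex Matrix.vec \<Rightarrow> complex Matrix.vec pmf" where
  "measure_snd P N \<psi> = map_pmf (collapse_snd P N \<psi>) (outcome_snd P N \<psi>)"

text \<open>The output distribution of the counting algorithm for \<open>P = 2\<^sup>p\<close>, \<open>N = 2\<^sup>n\<close>.
  The flag \<open>meas\<close> says whether the optional measurement of the second register is performed.\<close>

definition quantum_count :: "bool \<Rightarrow> nat \<Rightarrow> (nat \<Rightarrow> nat) \<Rightarrow> nat \<Rightarrow> real pmf" where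
  "quantum_count meas n F p =
    (let N = 2 ^ n; P = 2 ^ p;
         \<psi>0 = kron_mat (walsh_hadamard p) (walsh_hadamard n) *\<^sub>v
                kron_vec (unit_vec P 0) (unit_vec N 0);
         \<psi>1 = controlled_power P N (grover_iteration n F) *\<^sub>v \<psi>0
     in do {
       \<psi>2 \<leftarrow> (if meas then measure_snd P N \<psi>1 else return_pmf \<psi>1);
       let \<psi>3 = kron_mat (qft P) (1\<^sub>m N) *\<^sub>v \<psi>2;
       f0 \<leftarrow> measure_fst P N \<psi>3;
       let f = (if real f0 > real P / 2 then P - f0 else f0);
       return_pmf (real N * (sin (real f * pi / real P))\<^sup>2)
     })"

lemma sum_product_index:
  fixes g :: "nat \<Rightarrow> 'a :: comm_monoid_add"
  shows "(\<Sum>i<P * N. g i) = (\<Sum>m<P. \<Sum>x<N. g (m * N + x))"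
proof (induction P)
  case (Suc P)
  have "(\<Sum>i<M + K. g i) = (\<Sum>i<M. g i) + (\<Sum>x<K. g (M + x))" for M K
    by (induction K) (simp_all add: add.assoc)
  from this[of "P * N" N] show ?case using Suc by (simp add: add.commute)
qed simp

lemma controlled_power_kron_vec:
  assumes "G \<in> carrier_mat N N" "v \<in> carrier_vec N" "m < P"
  shows "controlled_power P N G *\<^sub>v kron_vec (unit_vec P m) v =
    kron_vec (unit_vec P m) ((G ^\<^sub>m m) *\<^sub>v v)"
proof (rule eq_vecI)
  have Gm: "G ^\<^sub>m k \<in> carrier_mat N N" for k using assms(1) by simp
  have dims: "dim_vec v = N" "dim_row (G ^\<^sub>m k) = N" "dim_col (G ^\<^sub>m k) = N" for k
    using assms(2) Gm[of k] by auto
  show "dim_vec (controlled_power P N G *\<^sub>v kron_vec (unit_vec P m) v) =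
    dim_vec (kron_vec (unit_vec P m) ((G ^\<^sub>m m) *\<^sub>v v))"
    using dims by (simp add: controlled_power_def kron_vec_def)
  fix i assume "i < dim_vec (kron_vec (unit_vec P m) ((G ^\<^sub>m m) *\<^sub>v v))"
  then have i: "i < P * N" using dims by (simp add: kron_vec_def)
  then have N: "N > 0" by (cases N) auto
  have iN: "i div N < P" "i mod N < N"
    using i N by (simp_all add: less_mult_imp_div_less)
  have "(controlled_power P N G *\<^sub>v kron_vec (unit_vec P m) v) $ i =
      (\<Sum>j<P * N. (if i div N = j div N then (G ^\<^sub>m (j div N)) $$ (i mod N, j mod N) else 0) *
        (unit_vec P m $ (j div N) * v $ (j mod N)))"
    using i dims
    by (simp add: controlled_power_def kron_vec_def scalar_prod_def atLeast0LessThan)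
  also have "\<dots> = (\<Sum>k<P. \<Sum>x<N. (if i div N = k then (G ^\<^sub>m k) $$ (i mod N, x) else 0) *
        (unit_vec P m $ k * v $ x))"
    unfolding sum_product_index by (intro sum.cong refl) (use N in simp)
  also have "\<dots> = (\<Sum>k<P. if k = i div N then
        (\<Sum>x<N. (G ^\<^sub>m k) $$ (i mod N, x) * (unit_vec P m $ k * v $ x)) else 0)"
    by (intro sum.cong refl) auto
  also have "\<dots> = (\<Sum>x<N. (G ^\<^sub>m (i div N)) $$ (i mod N, x) * (unit_vec P m $ (i div N) * v $ x))"
    using iN by simp
  also have "\<dots> = unit_vec P m $ (i div N) * (\<Sum>x<N. (G ^\<^sub>m m) $$ (i mod N, x) * v $ x)"
    using iN assms(3) by (auto simp: unit_vec_def)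
  also have "\<dots> = kron_vec (unit_vec P m) ((G ^\<^sub>m m) *\<^sub>v v) $ i"
    using i iN dims by (simp add: kron_vec_def scalar_prod_def atLeast0LessThan)
  finally show "(controlled_power P N G *\<^sub>v kron_vec (unit_vec P m) v) $ i =
    kron_vec (unit_vec P m) ((G ^\<^sub>m m) *\<^sub>v v) $ i" .
qed

lemma pmf_embed_finite:
  fixes f :: "nat \<Rightarrow> real"
  assumes "\<And>k. f k \<ge> 0" "\<And>k. k \<ge> K \<Longrightarrow> f k = 0" "(\<Sum>k<K. f k) = 1"
  shows "pmf (embed_pmf f) k = f k"
proof (rule pmf_embed_pmf)
  have "(\<integral>\<^sup>+k. ennreal (f k) \<partial>count_space UNIV) = (\<Sum>k<K. ennreal (f k))"
    by (rule nn_integral_count_space'[of "{..<K}"]) (use assms in \<open>auto simp: not_less\<close>)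
  also have "\<dots> = 1" using assms by (simp add: sum_ennreal)
  finally show "(\<integral>\<^sup>+k. ennreal (f k) \<partial>count_space UNIV) = 1" .
qed (rule assms)

lemma pmf_measure_fst:
  assumes "(\<Sum>i<P * N. (cmod (\<psi> $ i))\<^sup>2) = 1"
  shows "pmf (measure_fst P N \<psi>) m = prob_fst P N \<psi> m"
  unfolding measure_fst_def
  by (rule pmf_embed_finite[where K = P])
    (use assms in \<open>auto simp: prob_fst_def sum_product_index sum_nonneg\<close>)

lemma pmf_outcome_snd:
  assumes "(\<Sum>i<P * N. (cmod (\<psi> $ i))\<^sup>2) = 1"
  shows "pmf (outcome_snd P N \<psi>) x = prob_snd P N \<psi> x"
proof -
  have "(\<Sum>x<N. prob_snd P N \<psi> x) = (\<Sum>x<N. \<Sum>m<P. (cmod (\<psi> $ (m * N + x)))\<^sup>2)"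
    by (simp add: prob_snd_def)
  also have "\<dots> = 1" using assms unfolding sum_product_index by (subst sum.swap) simp
  finally show ?thesis unfolding outcome_snd_def
    by (intro pmf_embed_finite[where K = N]) (auto simp: prob_snd_def sum_nonneg)
qed

end

theory Submission
  imports Defs
begin

text \<open>Write \<open>t/N = sin\<^sup>2 \<theta>\<close>. Every power of the Grover iteration keeps the register in the plane
  spanned by the uniform superpositions of the solutions and of the non-solutions, where it rotates
  by \<open>2\<theta>\<close>. After the Fourier transform the outcome \<open>l\<close> therefore has probability
  \<open>(K(\<pi>l/P - \<theta>) + K(\<pi>l/P + \<theta>)) / 2\<close> with the Fejer kernel
  \<open>K(y) = sin\<^sup>2(Py) / (P sin y)\<^sup>2\<close>. The two integers \<open>l\<close> next to \<open>P\<theta>/\<pi>\<close> carry at least \<open>8/\<pi>\<^sup>2\<close> of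
  the first summand, and their mirror images \<open>P - l\<close> carry as much of the second; for all of them
  the estimated angle is within \<open>\<pi>/P\<close> of \<open>\<theta>\<close>. Measuring the second register first changes nothing
  because the operation on the first register acts on every branch separately and is unitary.\<close>

subsection \<open>Bounds for the Fejer kernel\<close>

text \<open>The Lagrange remainder of order 6 is \<open>- cos t * x^6 / 720\<close>, and this is at
  least \<open>- x^6 / 720\<close> for either sign of \<open>x\<close>. It serves the range of
  \<open>cos_half_pi_ge\<close> that contains \<open>u = 0\<close>.\<close>

lemma cos_ge_taylor6: "cos x \<ge> 1 - x\<^sup>2/2 + x^4/24 - x^6/720" for x :: real
proof -
  obtain t where t: "cos x = (\<Sum>m<6. cos_coeff m * x ^ m) + cos (t + 1/2 * real 6 * pi)
      / fact 6 * x ^ 6"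
    using Maclaurin_cos_expansion[of x 6] by blast
  have "cos (t + 1/2 * real 6 * pi) = - cos t"
    by (simp add: cos_add)
  moreover have "x^6 * cos t \<le> x^6 * 1" by (intro mult_left_mono) auto
  moreover have "(\<Sum>m<6. cos_coeff m * x ^ m) = 1 - x\<^sup>2/2 + x^4/24"
    by (simp add: lessThan_nat_numeral lessThan_Suc cos_coeff_def fact_numeral)
  ultimately show ?thesis using t by (simp add: fact_numeral mult.commute)
qed

text \<open>The remainder is bounded only in absolute value, hence \<open>x^5/120\<close> is
  subtracted although the Taylor term itself is positive. It serves the range of
  \<open>cos_half_pi_ge\<close> that contains \<open>u = 1\<close>.\<close>

lemma sin_ge_taylor5: "x \<ge> 0 \<Longrightarrow> sin x \<ge> x - x^3/6 - x^5/120" for x :: real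
proof -
  assume "x \<ge> 0"
  moreover have "(\<Sum>m<5. sin_coeff m * x ^ m) = x - x^3/6"
    by (simp add: lessThan_nat_numeral lessThan_Suc sin_coeff_def fact_numeral)
  ultimately have "\<bar>sin x - (x - x^3/6)\<bar> \<le> x^5/120"
    using Maclaurin_sin_bound[of x 5] by (simp add: fact_numeral)
  then show ?thesis by linarith
qed

text \<open>The first factor is that of Euler's product for the cosine; the others are weakened to
  \<open>1 - u\<^sup>2/4\<close>. There is equality at \<open>u = 0\<close> and \<open>u = 1\<close>, so each end needs its own expansion.\<close>

lemma cos_half_pi_ge:
  fixes u :: real
  assumes "0 \<le> u" "u \<le> 1"
  shows "(1 - u\<^sup>2) * (1 - u\<^sup>2/4) \<le> cos (pi * u / 2)"
proof (cases "u \<le> 7/10")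
  case True
  \<comment> \<open>Both sides become polynomials in \<open>w\<close>. The surplus
    \<open>5/4 - a/2 > 0\<close> in the linear coefficient pays for the cubic term, because
    \<open>w\<close> is at most 49/100; rational bounds on \<open>a\<close> then leave linear
    arithmetic in the powers of \<open>w\<close>.\<close>
  define w a where "w = u\<^sup>2" and "a = (pi/2)\<^sup>2"
  have w: "0 \<le> w" "w \<le> 49/100"
    using power_mono[OF True assms(1), of 2] by (simp_all add: w_def power2_eq_square)
  have a: "2467/1000 \<le> a" "a \<le> 24675/10000"
    using power_mono[of "15707/10000" "pi/2" 2] power_mono[of "pi/2" "15708/10000" 2] pi_approx
    by (simp_all add: a_def power2_eq_square)
  have "a^2 \<ge> (2467/1000)^2" "a^3 \<le> (24675/10000)^3"
    using a by (auto intro!: power_mono)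
  then have a23: "a^2 \<ge> 6086/1000" "a^3 \<le> 15030/1000"
      by (simp_all add: power2_eq_square power3_eq_cube)
  have "a * w \<le> 24675/10000 * w" "a^2 * w^2 \<ge> 6086/1000 * w^2" "a^3 * w^3 \<le> 15030/1000 * w^3"
    using a(2) a23 w(1) by (simp_all only: mult_right_mono zero_le_power)
  moreover have "w^3 \<le> 49/100 * w^2"
      using mult_right_mono[OF w(2), of "w^2"] by (simp add: eval_nat_numeral)
  moreover have "w^2 \<le> 49/100 * w" using mult_right_mono[OF w(2) w(1)] by (simp add: eval_nat_numeral)
  moreover have "w^2 \<ge> 0" by simp
  ultimately have "1 - a*w/2 + a^2*w^2/24 - a^3*w^3/720 \<ge> 1 - 5/4*w + w^2/4"
    using w by linarith
  moreover have "(1 - u\<^sup>2) * (1 - u\<^sup>2/4) = 1 - 5/4*w + w^2/4"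
    by (simp add: w_def field_simps power2_eq_square)
  moreover have "(pi*u/2)\<^sup>2 = a*w" "(pi*u/2)^4 = a^2*w^2" "(pi*u/2)^6 = a^3*w^3"
    by (simp_all add: a_def w_def power_mult_distrib power_divide flip: power_mult)
  ultimately show ?thesis using cos_ge_taylor6[of "pi*u/2"] by simp
next
  case False
  \<comment> \<open>Expansion around \<open>u = 1\<close>, where \<open>cos (pi * u / 2)\<close> is
    \<open>sin (b * v)\<close>. Its slope \<open>b = pi/2\<close> exceeds the slope 3/2 of the
    polynomial at \<open>v = 0\<close>.\<close>
  define v b where "v = 1 - u" and "b = pi/2"
  have v: "0 \<le> v" "v \<le> 3/10" using assms False by (auto simp: v_def)
  have b: "15707/10000 \<le> b" "b \<le> 15708/10000" using pi_approx by (auto simp: b_def)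
  have "b^3 \<le> (15708/10000)^3" "b^5 \<le> (15708/10000)^5" using b by (auto intro!: power_mono)
  then have b35: "b^3 \<le> 39/10" "b^5 \<le> 10" by (simp_all add: eval_nat_numeral)
  have "b * v \<ge> 15707/10000 * v" "b^3 * v^3 \<le> 39/10 * v^3" "b^5 * v^5 \<le> 10 * v^5"
    using b(1) b35 v(1) by (simp_all only: mult_right_mono zero_le_power)
  moreover have "v^2 \<le> 3/10 * v" using mult_right_mono[OF v(2) v(1)] by (simp add: eval_nat_numeral)
  moreover have "v^3 \<le> 3/10 * v^2"
      using mult_right_mono[OF v(2), of "v^2"] by (simp add: eval_nat_numeral)
  moreover have "v^5 \<le> 3/10 * v^4" "v^4 \<le> 3/10 * v^3"
    using mult_right_mono[OF v(2), of "v^4"] mult_right_mono[OF v(2), of "v^3"] v(1)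
    by (simp_all add: eval_nat_numeral)
  \<comment> \<open>The surplus in the cubic coefficient is needed against \<open>v^2/4\<close>, so
    \<open>v^3\<close> must be bounded from below. The bound is
    \<open>v * (v - 3/10)^2 \<ge> 0\<close>, tight at the far end \<open>v = 3/10\<close> of the
    range.\<close>
  moreover have "v^3 \<ge> 3/5 * v^2 - 9/100 * v"
    using mult_nonneg_nonneg[OF v(1) zero_le_power2[of "v - 3/10"]]
    by (simp add: power2_eq_square power3_eq_cube algebra_simps)
  moreover have "v^3 \<ge> 0" "v^2 \<ge> 0" "v^4 \<ge> 0" using v by simp_all
  ultimately have "b * v - b^3 * v^3/6 - b^5 * v^5/120 \<ge> 3/2 * v + v^2/4 - v^3 + v^4/4"
    using v by linarith
  moreover have "(1 - u\<^sup>2) * (1 - u\<^sup>2/4) = 3/2 * v + v^2/4 - v^3 + v^4/4"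
    by (simp add: v_def field_simps power2_eq_square power3_eq_cube power4_eq_xxxx)
  moreover have "cos (pi * u / 2) = sin (b * v)"
  proof -
    have "b * v = pi / 2 - pi * u / 2" by (simp add: b_def v_def field_simps)
    then show ?thesis by (simp add: cos_sin_eq)
  qed
  ultimately show ?thesis using sin_ge_taylor5[of "b * v"] v b by (simp add: power_mult_distrib)
qed

text \<open>This is the source of the constant 8, attained at \<open>d = 1/2\<close>, halfway
  between two integers. The substitution \<open>u = \<bar>1 - 2*d\<bar>\<close> uses the symmetry
  between \<open>d\<close> and \<open>1 - d\<close> and turns the claim into
  \<open>(1 - u^2)^2 \<le> cos(pi u/2)^2 (1 + u^2)\<close>, which follows from
  \<open>cos_half_pi_ge\<close> since \<open>(1 - u^2/4)^2 (1 + u^2) \<ge> 1\<close> on the unit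
  interval.\<close>

lemma sinc_square_pair_ge:
  fixes d :: real
  assumes "0 < d" "d < 1"
  shows "8 \<le> (sin (pi * d))\<^sup>2 * (1/d\<^sup>2 + 1/(1-d)\<^sup>2)"
proof -
  define u where "u = \<bar>1 - 2*d\<bar>"
  have u: "0 \<le> u" "u < 1" and u2: "u\<^sup>2 = (1 - 2*d)\<^sup>2" using assms by (auto simp: u_def)
  have "sin (pi * d) = cos (pi / 2 - pi * d)" by (simp add: sin_cos_eq)
  also have "pi / 2 - pi * d = pi * (1 - 2*d) / 2" by (simp add: field_simps)
  also have "cos (pi * (1 - 2*d) / 2) = cos \<bar>pi * (1 - 2*d) / 2\<bar>" by (simp only: cos_abs_real)
  also have "\<bar>pi * (1 - 2*d) / 2\<bar> = pi * u / 2" by (simp add: u_def abs_mult)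
  finally have s: "sin (pi * d) = cos (pi * u / 2)" .
  have u1: "u\<^sup>2 < 1" using u by (simp add: power_less_one_iff abs_square_less_1)
  have "(1 - u\<^sup>2)\<^sup>2 \<le> (1 - u\<^sup>2)\<^sup>2 * ((1 - u\<^sup>2/4)\<^sup>2 * (1 + u\<^sup>2))"
  proof -
    have "u\<^sup>2 * u\<^sup>2 \<le> u\<^sup>2 * 1" using u1 by (intro mult_left_mono) auto
    moreover have "(1 - u\<^sup>2/4)\<^sup>2 * (1 + u\<^sup>2) = 1 + u\<^sup>2/2 - 7/16 * (u\<^sup>2*u\<^sup>2) + u\<^sup>2*u\<^sup>2*u\<^sup>2/16"
      by (simp add: field_simps power2_eq_square)
    moreover have "u\<^sup>2*u\<^sup>2*u\<^sup>2 \<ge> 0" by simp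
    ultimately have "1 \<le> (1 - u\<^sup>2/4)\<^sup>2 * (1 + u\<^sup>2)" using zero_le_power2[of u] by linarith
    then show ?thesis using mult_left_mono[of 1 _ "(1 - u\<^sup>2)\<^sup>2"] by simp
  qed
  also have "\<dots> = ((1 - u\<^sup>2) * (1 - u\<^sup>2/4))\<^sup>2 * (1 + u\<^sup>2)" by (simp add: power_mult_distrib)
  also have "\<dots> \<le> (cos (pi * u / 2))\<^sup>2 * (1 + u\<^sup>2)"
    using cos_half_pi_ge[of u] u u1 by (intro mult_right_mono power_mono) auto
  finally have *: "(1 - u\<^sup>2)\<^sup>2 \<le> (sin (pi * d))\<^sup>2 * (1 + u\<^sup>2)" using s by simp
  have "1 - u\<^sup>2 = 4 * (d * (1-d))" unfolding u2 by (simp add: algebra_simps power2_eq_square)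
  moreover have "1 + u\<^sup>2 = 2 * (d\<^sup>2 + (1-d)\<^sup>2)"
      unfolding u2 by (simp add: algebra_simps power2_eq_square)
  ultimately have "16 * (d\<^sup>2 * (1-d)\<^sup>2) \<le> 2 * ((sin (pi * d))\<^sup>2 * (d\<^sup>2 + (1-d)\<^sup>2))"
    using * by (simp only: power_mult_distrib mult.left_commute[of _ 2]) simp
  then have "8 * (d\<^sup>2 * (1-d)\<^sup>2) \<le> (sin (pi * d))\<^sup>2 * (d\<^sup>2 + (1-d)\<^sup>2)"
    by linarith
  then have "8 \<le> (sin (pi * d))\<^sup>2 * (d\<^sup>2 + (1-d)\<^sup>2) / (d\<^sup>2 * (1-d)\<^sup>2)"
    using assms by (simp add: pos_le_divide_eq)
  also have "\<dots> = (sin (pi * d))\<^sup>2 * (1/d\<^sup>2 + 1/(1-d)\<^sup>2)"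
    using assms by (simp add: field_simps)
  finally show ?thesis .
qed

section \<open>Geometric sums of phases and their modulus\<close>

text \<open>The Fejer kernel of the overview is \<open>(cmod (dirichlet_sum P y))^2 / P^2\<close>.
  Working with the sum instead of the quotient of sines gives the right value \<open>P\<close> at
  multiples of pi as well.\<close>

definition dirichlet_sum :: "nat \<Rightarrow> real \<Rightarrow> complex" where
  "dirichlet_sum P y = (\<Sum>m<P. cis (2 * y * real m))"

lemma dirichlet_sum_minus: "dirichlet_sum P (- y) = cnj (dirichlet_sum P y)"
  by (simp add: dirichlet_sum_def cis_cnj)

lemma dirichlet_sum_add_pi: "dirichlet_sum P (y + pi) = dirichlet_sum P y"
proof -
  have "cis (2 * (y + pi) * real m) = cis (2 * y * real m)" for m
  proof -
    have "cis (2 * (y + pi) * real m) = cis (2 * y * real m) * cis (2 * pi * real m)"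
      by (simp only: cis_mult ring_distribs)
    then show ?thesis by (simp add: cis_multiple_2pi)
  qed
  then show ?thesis by (simp add: dirichlet_sum_def)
qed

text \<open>The geometric series, with \<open>cmod (cis (2 * x) - 1) = 2 * \<bar>sin x\<bar>\<close>
  on both sides. The product form also covers the zeros of \<open>sin y\<close>.\<close>

lemma cmod_dirichlet_sum_mult_sin: "cmod (dirichlet_sum P y) * \<bar>sin y\<bar> = \<bar>sin (real P * y)\<bar>"
proof -
  have c: "cmod (cis (2 * x) - 1) = 2 * \<bar>sin x\<bar>" for x
  proof -
    have "cis (2 * x) - 1 = cis x * (cis x - cis (- x))" by (simp add: cis_mult algebra_simps)
    also have "cis x - cis (- x) = 2 * \<i> * complex_of_real (sin x)" by (simp add: complex_eq_iff)
    finally show ?thesis by (simp add: norm_mult)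
  qed
  have "dirichlet_sum P y * (cis (2 * y) - 1) = cis (2 * (real P * y)) - 1"
  proof (induction P)
    case (Suc P)
    have "cis (2 * (real P * y)) * cis (2 * y) = cis (2 * (real (Suc P) * y))"
      by (simp add: cis_mult algebra_simps)
    with Suc show ?case by (simp add: dirichlet_sum_def algebra_simps)
  qed (simp add: dirichlet_sum_def)
  then have "cmod (dirichlet_sum P y) * cmod (cis (2 * y) - 1) = cmod (cis (2 * (real P * y)) - 1)"
    by (metis norm_mult)
  then show ?thesis unfolding c by simp
qed

lemma dirichlet_sum_zero: "dirichlet_sum P 0 = of_nat P"
  by (simp add: dirichlet_sum_def)

text \<open>Replacing \<open>\<bar>sin y\<bar>\<close> by the larger \<open>\<bar>y\<bar>\<close>
  turns the kernel into a squared sinc: at \<open>y = pi / P * d\<close>, after division by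
  \<open>P^2\<close>, the bound depends on \<open>d\<close> alone.\<close>

lemma cmod_dirichlet_sum_sq_ge:
  assumes "y \<noteq> 0"
  shows "(sin (real P * y))\<^sup>2 / y\<^sup>2 \<le> (cmod (dirichlet_sum P y))\<^sup>2"
proof -
  have "(sin (real P * y))\<^sup>2 = (cmod (dirichlet_sum P y))\<^sup>2 * (sin y)\<^sup>2"
    using cmod_dirichlet_sum_mult_sin[of P y] by (metis power2_abs power_mult_distrib)
  also have "\<dots> \<le> (cmod (dirichlet_sum P y))\<^sup>2 * y\<^sup>2"
    by (intro mult_left_mono) (use abs_sin_x_le_abs_x[of y] in \<open>auto simp: abs_le_square_iff\<close>)
  finally show ?thesis using assms by (simp add: pos_divide_le_eq)
qed

text \<open>Here \<open>x\<close> plays the role of the exact phase in units of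
  \<open>pi / P\<close>, and \<open>f\<close>, \<open>f + 1\<close> are the outcomes on either side
  of it.\<close>

lemma dirichlet_pair_ge:
  fixes x :: real
  assumes "P > 0" "real f \<le> x" "x < real f + 1"
  shows "8 / pi\<^sup>2 * (real P)\<^sup>2 \<le> (cmod (dirichlet_sum P (pi / real P * (real f - x))))\<^sup>2
       + (cmod (dirichlet_sum P (pi / real P * (real (f + 1) - x))))\<^sup>2"
\<comment> \<open>At an integer \<open>x\<close> the first term alone is \<open>P^2\<close>, and
  \<open>8 / pi^2 \<le> 1\<close>. The sinc bound divides by the distance to \<open>f\<close> and
  therefore needs this case split.\<close>
proof (cases "x = real f")
  case True
  have "8 \<le> pi\<^sup>2" using power_mono[of 3 pi 2] pi_gt3 by simp
  then have "8 / pi\<^sup>2 * (real P)\<^sup>2 \<le> 1 * (real P)\<^sup>2"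
    by (intro mult_right_mono) auto
  then show ?thesis using True by (simp add: dirichlet_sum_zero add_increasing2)
next
  case False
  define d where "d = x - real f"
  have d: "0 < d" "d < 1" using assms False by (auto simp: d_def)
  have "8 / pi\<^sup>2 * (real P)\<^sup>2 \<le> (sin (pi * d))\<^sup>2 * (1/d\<^sup>2 + 1/(1-d)\<^sup>2) / pi\<^sup>2 * (real P)\<^sup>2"
    using sinc_square_pair_ge[OF d] by (intro mult_right_mono divide_right_mono) auto
  also have "\<dots> = (sin (pi * d))\<^sup>2 / (pi / real P * d)\<^sup>2 + (sin (pi * d))\<^sup>2 / (pi / real P * (1-d))\<^sup>2"
  proof -
    have "S * (1/a + 1/b) / q * p = S / (q / p * a) + S / (q / p * b)"
      if "p \<noteq> 0" "q \<noteq> 0" "a \<noteq> 0" "b \<noteq> 0" for S a b q p :: real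
      using that by (simp add: field_simps)
    from this[of "(real P)\<^sup>2" "pi\<^sup>2" "d\<^sup>2" "(1-d)\<^sup>2"] show ?thesis
      using assms d by (simp add: power_mult_distrib power_divide)
  qed
  also have "(sin (pi * d))\<^sup>2 = (sin (real P * (pi / real P * (-d))))\<^sup>2"
    using assms by simp
  also have "(sin (real P * (pi / real P * (-d))))\<^sup>2 / (pi / real P * d)\<^sup>2
      \<le> (cmod (dirichlet_sum P (pi / real P * (-d))))\<^sup>2"
    using cmod_dirichlet_sum_sq_ge[of "pi / real P * (-d)" P] assms d by simp
  \<comment> \<open>Since \<open>sin (pi - pi * d) = sin (pi * d)\<close>, both neighbours have the
    same numerator, so one factor serves both terms.\<close>
  also have "(sin (real P * (pi / real P * (-d))))\<^sup>2 = (sin (real P * (pi / real P * (1-d))))\<^sup>2"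
    using assms by (simp add: right_diff_distrib sin_diff)
  also have "(sin (real P * (pi / real P * (1-d))))\<^sup>2 / (pi / real P * (1-d))\<^sup>2
      \<le> (cmod (dirichlet_sum P (pi / real P * (1-d))))\<^sup>2"
    using cmod_dirichlet_sum_sq_ge[of "pi / real P * (1-d)" P] assms d by simp
  finally show ?thesis by (simp add: d_def algebra_simps)
qed

section \<open>From an error in the angle to an error in the squared sine\<close>

text \<open>The difference of squares is \<open>sin (2*th + d) * sin d\<close>. The first factor is
  at most \<open>2 * sin th + e\<close> and the second is strictly below \<open>e\<close>, which is
  where the strict inequality of the theorem comes from.\<close>

lemma abs_sin_sq_diff_less:
  fixes th e :: real
  assumes "0 < e" "\<bar>d\<bar> \<le> e" "0 \<le> sin th"
  shows "\<bar>(sin th)\<^sup>2 - (sin (th + d))\<^sup>2\<bar> < 2 * e * sin th + e\<^sup>2"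
proof -
  have id: "(sin (th + d))\<^sup>2 - (sin th)\<^sup>2 = sin (2*th + d) * sin d"
  proof -
    have "sin (2*th + d) * sin d = sin (th + (th + d)) * sin ((th + d) - th)"
      by (simp add: algebra_simps)
    also have "\<dots> = (sin (th + d))\<^sup>2 * (cos th)\<^sup>2 - (sin th)\<^sup>2 * (cos (th + d))\<^sup>2"
      unfolding sin_add[of th "th + d"] sin_diff[of "th + d" th]
      by (simp only: algebra_simps power2_eq_square)
    finally show ?thesis by (simp add: cos_squared_eq algebra_simps)
  qed
  \<comment> \<open>If \<open>sin (d/2)\<close> vanishes then so does \<open>sin d\<close>, and
    \<open>e > 0\<close> suffices. Otherwise \<open>\<bar>cos (d/2)\<bar> < 1\<close> makes the
    double-angle estimate strict, even for \<open>\<bar>d\<bar> = e\<close>.\<close>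
  have sd: "\<bar>sin d\<bar> < e"
  proof (cases "sin (d/2) = 0")
    case True
    then show ?thesis using sin_double[of "d/2"] assms by simp
  next
    case False
    then have "0 < (sin (d/2))\<^sup>2" by simp
    then have "(cos (d/2))\<^sup>2 < 1" using sin_cos_squared_add[of "d/2"] by linarith
    then have "\<bar>cos (d/2)\<bar> < 1" by (simp add: abs_square_less_1)
    then have "2 * \<bar>sin (d/2)\<bar> * \<bar>cos (d/2)\<bar> < 2 * \<bar>sin (d/2)\<bar> * 1"
      using False by (intro mult_strict_left_mono) auto
    then have "\<bar>sin d\<bar> < 2 * \<bar>sin (d/2)\<bar>" using sin_double[of "d/2"] by (simp add: abs_mult)
    also have "\<dots> \<le> 2 * \<bar>d/2\<bar>" using abs_sin_x_le_abs_x[of "d/2"] by simp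
    finally show ?thesis using assms by simp
  qed
  have "\<bar>sin (2*th + d)\<bar> \<le> \<bar>sin (2*th)\<bar> * \<bar>cos d\<bar> + \<bar>cos (2*th)\<bar> * \<bar>sin d\<bar>"
    by (simp add: sin_add abs_triangle_ineq[THEN order_trans] flip: abs_mult)
  also have "\<dots> \<le> \<bar>sin (2*th)\<bar> * 1 + 1 * \<bar>sin d\<bar>"
    by (intro add_mono mult_mono) auto
  also have "\<bar>sin (2*th)\<bar> \<le> 2 * sin th * 1"
    unfolding sin_double abs_mult using assms by (intro mult_mono) auto
  finally have "\<bar>sin (2*th + d)\<bar> \<le> 2 * sin th + e" using sd by simp
  then have "\<bar>sin (2*th + d)\<bar> * \<bar>sin d\<bar> \<le> (2 * sin th + e) * \<bar>sin d\<bar>"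
    by (intro mult_right_mono) auto
  also have "\<dots> < (2 * sin th + e) * e"
    using sd assms by (intro mult_strict_left_mono) auto
  finally have "\<bar>(sin (th + d))\<^sup>2 - (sin th)\<^sup>2\<bar> < (2 * sin th + e) * e"
    unfolding id abs_mult .
  then show ?thesis by (simp add: algebra_simps power2_eq_square abs_minus_commute)
qed

subsection \<open>Kronecker products and the Grover iteration\<close>

lemma kron_mat_carrier [simp]:
  "A \<in> carrier_mat a b \<Longrightarrow> B \<in> carrier_mat c d \<Longrightarrow> kron_mat A B \<in> carrier_mat (a * c) (b * d)"
  by (auto simp: kron_mat_def)

lemma product_index_less:
  fixes l x :: nat
  assumes "l < P" "x < N"
  shows "l * N + x < P * N"
proof -
  have "l * N + x < Suc l * N" using assms by simp
  also have "\<dots> \<le> P * N" using assms by (intro mult_right_mono) auto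
  finally show ?thesis .
qed

text \<open>The sum over the combined index splits into a product of two sums. The rule allows the
  Walsh-Hadamard matrix to be squared one tensor factor at a time.\<close>

lemma kron_mat_mult:
  assumes "A \<in> carrier_mat a b" "C \<in> carrier_mat b c" "B \<in> carrier_mat d e" "D \<in> carrier_mat e f"
  shows "kron_mat A B * kron_mat C D = kron_mat (A * C) (B * D)"
proof (rule eq_matI)
  show "dim_row (kron_mat A B * kron_mat C D) = dim_row (kron_mat (A * C) (B * D))"
    "dim_col (kron_mat A B * kron_mat C D) = dim_col (kron_mat (A * C) (B * D))"
    using assms by (auto simp: kron_mat_def)
  fix i j assume "i < dim_row (kron_mat (A * C) (B * D))" "j < dim_col (kron_mat (A * C) (B * D))"
  then have ij: "i < a * d" "j < c * f" using assms by (auto simp: kron_mat_def)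
  then have pos: "d > 0" "f > 0" by (auto intro: Nat.gr0I)
  then have ij': "i div d < a" "i mod d < d" "j div f < c" "j mod f < f"
    using ij by (simp_all add: less_mult_imp_div_less)
  have "(kron_mat A B * kron_mat C D) $$ (i, j)
      = (\<Sum>k<b * e. (A $$ (i div d, k div e) * B $$ (i mod d, k mod e)) *
          (C $$ (k div e, j div f) * D $$ (k mod e, j mod f)))"
    using assms ij by (auto simp: kron_mat_def scalar_prod_def atLeast0LessThan)
  also have "\<dots> = (\<Sum>k<b. \<Sum>y<e. (A $$ (i div d, k) * C $$ (k, j div f)) *
      (B $$ (i mod d, y) * D $$ (y, j mod f)))"
    unfolding sum_product_index by (intro sum.cong refl) auto
  also have "\<dots> = (\<Sum>k<b. A $$ (i div d, k) * C $$ (k, j div f)) *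
      (\<Sum>y<e. B $$ (i mod d, y) * D $$ (y, j mod f))"
    by (simp add: sum_product)
  also have "\<dots> = kron_mat (A * C) (B * D) $$ (i, j)"
    using assms ij ij' by (auto simp: kron_mat_def scalar_prod_def atLeast0LessThan)
  finally show "(kron_mat A B * kron_mat C D) $$ (i, j) = kron_mat (A * C) (B * D) $$ (i, j)" .
qed

lemma kron_mat_one: "kron_mat (1\<^sub>m a) (1\<^sub>m b) = 1\<^sub>m (a * b)"
proof (rule eq_matI)
  fix i j assume "i < dim_row (1\<^sub>m (a * b))" "j < dim_col (1\<^sub>m (a * b))"
  then have ij: "i < a * b" "j < a * b" by auto
  then have b: "b > 0" by (auto intro: Nat.gr0I)
  have "i = j \<longleftrightarrow> i div b = j div b \<and> i mod b = j mod b"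
    by (metis div_mult_mod_eq)
  then show "kron_mat (1\<^sub>m a) (1\<^sub>m b) $$ (i, j) = 1\<^sub>m (a * b) $$ (i, j)"
    using ij b by (auto simp: kron_mat_def less_mult_imp_div_less)
qed (auto simp: kron_mat_def)

lemma kron_mat_mult_vec_index:
  assumes "A \<in> carrier_mat P' P" "B \<in> carrier_mat N' N" "dim_vec \<psi> = P * N" "l < P'" "x < N'"
  shows "(kron_mat A B *\<^sub>v \<psi>) $ (l * N' + x)
      = (\<Sum>m<P. \<Sum>y<N. A $$ (l, m) * B $$ (x, y) * \<psi> $ (m * N + y))"
proof -
  have "(kron_mat A B *\<^sub>v \<psi>) $ (l * N' + x)
      = (\<Sum>j<P * N. A $$ (l, j div N) * B $$ (x, j mod N) * \<psi> $ j)"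
    using assms product_index_less[OF assms(4,5)]
    by (auto simp: kron_mat_def scalar_prod_def atLeast0LessThan)
  also have "\<dots> = (\<Sum>m<P. \<Sum>y<N. A $$ (l, m) * B $$ (x, y) * \<psi> $ (m * N + y))"
    unfolding sum_product_index by (intro sum.cong refl) auto
  finally show ?thesis .
qed

lemma kron_mat_one_mult_vec_index:
  assumes "A \<in> carrier_mat P' P" "dim_vec \<psi> = P * N" "l < P'" "x < N"
  shows "(kron_mat A (1\<^sub>m N) *\<^sub>v \<psi>) $ (l * N + x) = (\<Sum>m<P. A $$ (l, m) * \<psi> $ (m * N + x))"
proof -
  have "(kron_mat A (1\<^sub>m N) *\<^sub>v \<psi>) $ (l * N + x)
      = (\<Sum>m<P. \<Sum>y<N. A $$ (l, m) * 1\<^sub>m N $$ (x, y) * \<psi> $ (m * N + y))"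
    using assms by (intro kron_mat_mult_vec_index) auto
  also have "\<dots> = (\<Sum>m<P. \<Sum>y<N. if y = x then A $$ (l, m) * \<psi> $ (m * N + x) else 0)"
    using assms by (intro sum.cong refl) auto
  finally show ?thesis using assms by simp
qed

section \<open>The Walsh-Hadamard transform and inversion about the mean\<close>

lemma hadamard_gate_carrier: "hadamard_gate \<in> carrier_mat 2 2"
  by (rule carrier_matI) (simp_all add: hadamard_gate_def mat_of_rows_list_def)

lemma hadamard_gate_index:
  "i < 2 \<Longrightarrow> j < 2 \<Longrightarrow>
    hadamard_gate $$ (i, j) = (if i = 1 \<and> j = 1 then - 1 else 1) / complex_of_real (sqrt 2)"
  by (auto simp: hadamard_gate_def mat_of_rows_list_def less_2_cases_iff)

lemma hadamard_gate_squared: "hadamard_gate * hadamard_gate = 1\<^sub>m 2"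
proof (rule eq_matI)
  fix i j :: nat assume "i < dim_row (1\<^sub>m 2)" "j < dim_col (1\<^sub>m 2)"
  then have ij: "i < 2" "j < 2" by auto
  have "complex_of_real (sqrt 2) * complex_of_real (sqrt 2) = 2"
    by (simp flip: of_real_mult)
  then show "(hadamard_gate * hadamard_gate) $$ (i, j) = 1\<^sub>m 2 $$ (i, j)"
    using ij hadamard_gate_carrier
    by (auto simp: scalar_prod_def hadamard_gate_index less_2_cases_iff numeral_2_eq_2)
qed (use hadamard_gate_carrier in auto)

lemma walsh_hadamard_carrier [simp]: "walsh_hadamard n \<in> carrier_mat (2 ^ n) (2 ^ n)"
proof (induction n)
  case (Suc n)
  then show ?case using kron_mat_carrier[OF hadamard_gate_carrier Suc] by simp
qed simp

lemma walsh_hadamard_dim [simp]: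
  "dim_row (walsh_hadamard n) = 2 ^ n" "dim_col (walsh_hadamard n) = 2 ^ n"
  by (rule carrier_matD[OF walsh_hadamard_carrier])+

lemma walsh_hadamard_squared: "walsh_hadamard n * walsh_hadamard n = 1\<^sub>m (2 ^ n)"
proof (induction n)
  case (Suc n)
  then show ?case
    using kron_mat_mult[OF hadamard_gate_carrier hadamard_gate_carrier
        walsh_hadamard_carrier[of n] walsh_hadamard_carrier[of n]]
    by (simp add: hadamard_gate_squared kron_mat_one)
qed simp

text \<open>Column 0 produces the uniform initial superposition. Together with row 0 it gives the
  rank-one part of the diffusion operator.\<close>

lemma walsh_hadamard_first:
  "i < 2 ^ n \<Longrightarrow> walsh_hadamard n $$ (i, 0) = 1 / complex_of_real (sqrt (2 ^ n))"
  "i < 2 ^ n \<Longrightarrow> walsh_hadamard n $$ (0, i) = 1 / complex_of_real (sqrt (2 ^ n))"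
proof (induction n arbitrary: i)
  case (Suc n)
  have dim: "dim_row hadamard_gate = 2" "dim_col hadamard_gate = 2"
    using hadamard_gate_carrier by auto
  { case 1
    then have "i div 2 ^ n < 2" "i mod 2 ^ n < 2 ^ n" by (simp_all add: less_mult_imp_div_less)
    then show ?case using 1 Suc.IH(1)[of "i mod 2 ^ n"]
      by (simp add: kron_mat_def dim hadamard_gate_index real_sqrt_mult) }
  { case 2
    then have "i div 2 ^ n < 2" "i mod 2 ^ n < 2 ^ n" by (simp_all add: less_mult_imp_div_less)
    then show ?case using 2 Suc.IH(2)[of "i mod 2 ^ n"]
      by (simp add: kron_mat_def dim hadamard_gate_index real_sqrt_mult) }
qed simp_all

text \<open>A two-sided inverse excludes the result \<open>None\<close>, and uniqueness of inverses
  identifies whatever Gauss-Jordan elimination returns with \<open>B\<close>.\<close>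

lemma mat_inverse_eq_Some:
  fixes A :: "'a :: field mat"
  assumes "A \<in> carrier_mat n n" "B \<in> carrier_mat n n" "A * B = 1\<^sub>m n" "B * A = 1\<^sub>m n"
  shows "mat_inverse A = Some B"
proof (cases "mat_inverse A")
  case None
  have "A \<in> Units (ring_mat TYPE('a) n ())"
    using assms by (auto simp: Units_def ring_mat_def)
  then show ?thesis using mat_inverse(1)[OF assms(1) None, of "()"] by blast
next
  case (Some C)
  then have C: "A * C = 1\<^sub>m n" "C \<in> carrier_mat n n" using mat_inverse(2)[OF assms(1)] by auto
  have "C = (B * A) * C" using assms C by simp
  also have "\<dots> = B * (A * C)" using assms C by (intro assoc_mult_mat) auto
  also have "\<dots> = B" using assms C by simp
  finally show ?thesis using Some by simp
qed

text \<open>The reflection is \<open>I - 2 |0><0|\<close> and the transform is an involution, so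
  conjugation gives \<open>I - 2 |s><s|\<close> for the uniform vector \<open>s\<close>. All entries
  of \<open>|s><s|\<close> are \<open>1 / 2^n\<close>.\<close>

lemma diffusion_index:
  assumes "i < 2 ^ n" "j < 2 ^ n"
  shows "(walsh_hadamard n * zero_reflection (2 ^ n) * walsh_hadamard n) $$ (i, j) =
    (if i = j then 1 else 0) - 2 / 2 ^ n"
proof -
  let ?W = "walsh_hadamard n" and ?N = "2 ^ n :: nat"
  have "(?W * zero_reflection ?N) $$ (i, k) = ?W $$ (i, k) * (if k = 0 then - 1 else 1)"
      if "k < ?N" for k
  proof -
    have "(?W * zero_reflection ?N) $$ (i, k)
        = (\<Sum>l<?N. ?W $$ (i, l) * (if l = k then (if k = 0 then - 1 else 1) else 0))"
      using assms that by (simp add: zero_reflection_def scalar_prod_def atLeast0LessThan)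
    also have "\<dots> = (\<Sum>l<?N. if l = k then ?W $$ (i, k) * (if k = 0 then - 1 else 1) else 0)"
      by (intro sum.cong refl) auto
    finally show ?thesis using that by simp
  qed
  then have "(?W * zero_reflection ?N * ?W) $$ (i, j)
      = (\<Sum>k<?N. ?W $$ (i, k) * (if k = 0 then - 1 else 1) * ?W $$ (k, j))"
    using assms by (simp add: scalar_prod_def atLeast0LessThan zero_reflection_def)
  also have "\<dots> = (\<Sum>k<?N. ?W $$ (i, k) * ?W $$ (k, j)
      - (if k = 0 then 2 * ?W $$ (i, 0) * ?W $$ (0, j) else 0))"
    by (intro sum.cong refl) auto
  also have "\<dots> = (?W * ?W) $$ (i, j) - 2 * ?W $$ (i, 0) * ?W $$ (0, j)"
    using assms by (simp add: sum_subtractf scalar_prod_def atLeast0LessThan)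
  also have "\<dots> = (if i = j then 1 else 0) - 2 / complex_of_real (sqrt (2 ^ n) * sqrt (2 ^ n))"
    unfolding walsh_hadamard_squared using assms
        by (simp add: walsh_hadamard_first del: real_sqrt_mult_self)
  also have "sqrt (2 ^ n) * sqrt (2 ^ n) = 2 ^ n" by simp
  finally show ?thesis by (simp only: of_real_power of_real_numeral)
qed

lemma mult_mat_vec_index_sum:
  "A \<in> carrier_mat a b \<Longrightarrow> v \<in> carrier_vec b \<Longrightarrow> i < a \<Longrightarrow> (A *\<^sub>v v) $ i = (\<Sum>j<b. A $$ (i, j) * v $ j)"
  by (simp add: scalar_prod_def atLeast0LessThan)

lemma grover_iteration_eq:
  "grover_iteration n F =
    - (walsh_hadamard n * zero_reflection (2 ^ n) * walsh_hadamard n * phase_oracle (2 ^ n) F)"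
proof -
  have "mat_inverse (walsh_hadamard n) = Some (walsh_hadamard n)"
    by (intro mat_inverse_eq_Some[of _ "2 ^ n"] walsh_hadamard_carrier walsh_hadamard_squared)
  then show ?thesis by (simp only: grover_iteration_def option.sel)
qed

text \<open>The negated diffusion operator is inversion about the mean, applied after the sign flip
  of the oracle: twice the mean of the signed entries minus the signed entry.\<close>

lemma grover_iteration_carrier [simp]: "grover_iteration n F \<in> carrier_mat (2 ^ n) (2 ^ n)"
  and grover_iteration_mult_vec_index:
  "v \<in> carrier_vec (2 ^ n) \<Longrightarrow> x < 2 ^ n \<Longrightarrow> (grover_iteration n F *\<^sub>v v) $ x =
    2 / 2 ^ n * (\<Sum>y<2 ^ n. (- 1) ^ F y * v $ y) - (- 1) ^ F x * v $ x"
proof -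
  let ?N = "2 ^ n :: nat"
  define D where "D = walsh_hadamard n * zero_reflection ?N * walsh_hadamard n"
  have D: "D \<in> carrier_mat ?N ?N"
    unfolding D_def
    by (intro mult_carrier_mat[of _ _ ?N] walsh_hadamard_carrier) (simp add: zero_reflection_def)
  have D_index: "D $$ (x, y) = (if x = y then 1 else 0) - 2 / 2 ^ n" if "x < ?N" "y < ?N" for x y
    unfolding D_def by (rule diffusion_index[OF that])
  have S: "phase_oracle ?N F \<in> carrier_mat ?N ?N" by (simp add: phase_oracle_def)
  have G: "grover_iteration n F = - (D * phase_oracle ?N F)"
    by (simp only: grover_iteration_eq D_def)
  show "grover_iteration n F \<in> carrier_mat (2 ^ n) (2 ^ n)"
    unfolding G by (intro uminus_carrier_mat mult_carrier_mat[OF D S])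
  assume v: "v \<in> carrier_vec ?N" and x: "x < ?N"
  define w where "w = phase_oracle ?N F *\<^sub>v v"
  have w: "w \<in> carrier_vec ?N" unfolding w_def using S v by auto
  have w_index: "w $ y = (- 1) ^ F y * v $ y" if "y < ?N" for y
  proof -
    have "w $ y = (\<Sum>k<?N. (if y = k then (- 1) ^ F k else 0) * v $ k)"
      unfolding w_def mult_mat_vec_index_sum[OF S v that] using that by (simp add: phase_oracle_def)
    also have "\<dots> = (\<Sum>k<?N. if k = y then (- 1) ^ F k * v $ k else 0)"
      by (intro sum.cong refl) auto
    finally show ?thesis using that by simp
  qed
  have "grover_iteration n F *\<^sub>v v = - (D *\<^sub>v w)"
    unfolding G w_def using D S v by (simp add: uminus_mult_mat_vec assoc_mult_mat_vec[OF D S v])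
  then have "(grover_iteration n F *\<^sub>v v) $ x = - (\<Sum>y<?N. D $$ (x, y) * w $ y)"
    using D x mult_mat_vec_index_sum[OF D w x] by simp
  also have "(\<Sum>y<?N. D $$ (x, y) * w $ y) = (\<Sum>y<?N. (if y = x then w $ y else 0)
      - 2 / 2 ^ n * ((- 1) ^ F y * v $ y))"
    using x by (intro sum.cong refl) (simp add: D_index w_index algebra_simps)
  also have "\<dots> = (- 1) ^ F x * v $ x - 2 / 2 ^ n * (\<Sum>y<?N. (- 1) ^ F y * v $ y)"
    using x by (simp add: sum_subtractf sum_distrib_left w_index)
  finally show "(grover_iteration n F *\<^sub>v v) $ x =
    2 / 2 ^ n * (\<Sum>y<?N. (- 1) ^ F y * v $ y) - (- 1) ^ F x * v $ x" by simp
qed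

subsection \<open>Measurements and the quantum Fourier transform\<close>

lemma qft_carrier [simp]: "qft P \<in> carrier_mat P P"
  by (simp add: qft_def)

lemma qft_index:
  "l < P \<Longrightarrow> m < P \<Longrightarrow> qft P $$ (l, m) = cis (2 * (pi * real l / real P) * real m)
      / complex_of_real (sqrt (real P))"
  by (simp add: qft_def cis_conv_exp algebra_simps)

text \<open>The inner product of two columns is \<open>dirichlet_sum P y / P\<close> with
  \<open>P * y\<close> a multiple of pi. For distinct columns \<open>0 < \<bar>y\<bar> < pi\<close>,
  so \<open>sin y\<close> is nonzero and the sum must vanish.\<close>

lemma qft_columns_orthonormal:
  assumes "m < P" "k < P"
  shows "(\<Sum>l<P. qft P $$ (l, m) * cnj (qft P $$ (l, k))) = (if m = k then 1 else 0)"
proof -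
  define y where "y = pi * (real m - real k) / real P"
  have P: "P > 0" using assms by simp
  have sq: "complex_of_real (sqrt (real P)) * complex_of_real (sqrt (real P)) = of_nat P"
    by (simp flip: of_real_mult)
  have "qft P $$ (l, m) * cnj (qft P $$ (l, k)) = cis (2 * y * real l) / of_nat P" if "l < P" for l
  proof -
    have "2 * (pi * real l / real P) * real m + - (2 * (pi * real l / real P) * real k) = 2 * y * real l"
      using P by (simp add: y_def field_simps)
    then have "cis (2 * (pi * real l / real P) * real m) * cis (- (2 * (pi * real l / real P) * real k))
        = cis (2 * y * real l)"
      by (simp only: cis_mult)
    then show ?thesis using that assms by (simp add: qft_index cis_cnj sq)
  qed
  then have eq: "(\<Sum>l<P. qft P $$ (l, m) * cnj (qft P $$ (l, k))) = dirichlet_sum P y / of_nat P"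
    by (simp add: dirichlet_sum_def sum_divide_distrib)
  show ?thesis
  proof (cases "m = k")
    case True
    then show ?thesis unfolding eq using P by (simp add: y_def dirichlet_sum_zero)
  next
    case False
    have "\<bar>real m - real k\<bar> < real P" using assms by linarith
    then have "pi * \<bar>real m - real k\<bar> < pi * real P" by simp
    then have "\<bar>y\<bar> < pi" unfolding y_def abs_mult abs_divide using P by (simp add: pos_divide_less_eq)
    moreover have "y \<noteq> 0" using False P by (simp add: y_def)
    ultimately have "sin y \<noteq> 0" using sin_eq_0_pi[of y] by linarith
    moreover have "sin (real P * y) = 0"
    proof -
      have "real P * y = of_int (int m - int k) * pi" using P by (simp add: y_def)
      then show ?thesis by (simp only: sin_integer_2pi sin_times_pi_eq_0 Ints_of_int)
    qed
    ultimately have "dirichlet_sum P y = 0" using cmod_dirichlet_sum_mult_sin[of P y] by simp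
    then show ?thesis unfolding eq using False by simp
  qed
qed

text \<open>Each squared modulus is expanded as \<open>z * cnj z\<close>, and summing over
  \<open>l\<close> first leaves the diagonal terms. Arbitrary coefficients \<open>a\<close> are
  allowed so that the identity applies to every branch of the second register.\<close>

lemma qft_parseval: "(\<Sum>l<P. (cmod (\<Sum>m<P. qft P $$ (l, m) * a m))\<^sup>2) = (\<Sum>m<P. (cmod (a m))\<^sup>2)"
proof -
  have "complex_of_real (\<Sum>l<P. (cmod (\<Sum>m<P. qft P $$ (l, m) * a m))\<^sup>2)
      = (\<Sum>l<P. \<Sum>m<P. \<Sum>k<P. (qft P $$ (l, m) * cnj (qft P $$ (l, k))) * (a m * cnj (a k)))"
    unfolding of_real_sum complex_norm_square cnj_sum sum_product
    by (simp add: algebra_simps)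
  also have "\<dots> = (\<Sum>m<P. \<Sum>k<P. (\<Sum>l<P. qft P $$ (l, m) * cnj (qft P $$ (l, k))) * (a m * cnj (a k)))"
    unfolding sum_distrib_right by (rule trans[OF sum.swap], rule sum.cong[OF refl], rule sum.swap)
  also have "\<dots> = (\<Sum>m<P. \<Sum>k<P. if k = m then a m * cnj (a m) else 0)"
    by (intro sum.cong refl) (auto simp: qft_columns_orthonormal)
  also have "\<dots> = complex_of_real (\<Sum>m<P. (cmod (a m))\<^sup>2)"
    by (simp add: complex_norm_square del: of_real_power)
  finally show ?thesis by (simp only: of_real_eq_iff)
qed

lemma prob_fst_kron_one:
  assumes "A \<in> carrier_mat P P" "dim_vec \<psi> = P * N"
  shows "prob_fst P N (kron_mat A (1\<^sub>m N) *\<^sub>v \<psi>) l =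
    (if l < P then \<Sum>x<N. (cmod (\<Sum>m<P. A $$ (l, m) * \<psi> $ (m * N + x)))\<^sup>2 else 0)"
  using assms by (simp add: prob_fst_def kron_mat_one_mult_vec_index)

text \<open>The isometry \<open>iso\<close> keeps the total weight at 1, which is what
  \<open>embed_pmf\<close> requires to return the intended probabilities.\<close>

lemma pmf_measure_fst_kron_one:
  assumes A: "A \<in> carrier_mat P P"
    and iso: "\<And>a. (\<Sum>l<P. (cmod (\<Sum>m<P. A $$ (l, m) * a m))\<^sup>2) = (\<Sum>m<P. (cmod (a m))\<^sup>2)"
    and dim: "dim_vec \<psi> = P * N" and norm: "(\<Sum>i<P * N. (cmod (\<psi> $ i))\<^sup>2) = 1"
  shows "pmf (measure_fst P N (kron_mat A (1\<^sub>m N) *\<^sub>v \<psi>)) l =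
    (if l < P then \<Sum>x<N. (cmod (\<Sum>m<P. A $$ (l, m) * \<psi> $ (m * N + x)))\<^sup>2 else 0)"
proof -
  have "(\<Sum>i<P * N. (cmod ((kron_mat A (1\<^sub>m N) *\<^sub>v \<psi>) $ i))\<^sup>2)
      = (\<Sum>l<P. \<Sum>x<N. (cmod (\<Sum>m<P. A $$ (l, m) * \<psi> $ (m * N + x)))\<^sup>2)"
    unfolding sum_product_index using A dim by (simp add: kron_mat_one_mult_vec_index)
  also have "\<dots> = (\<Sum>x<N. \<Sum>m<P. (cmod (\<psi> $ (m * N + x)))\<^sup>2)"
    by (subst sum.swap) (simp add: iso)
  also have "\<dots> = 1" using norm unfolding sum_product_index by (subst sum.swap) simp
  finally show ?thesis
    using A dim by (simp add: pmf_measure_fst prob_fst_kron_one)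
qed

text \<open>Deferred measurement: \<open>A\<close> never mixes different values of the second
  register, so the conditional probability of \<open>l\<close> in branch \<open>x\<close> times the
  weight of that branch is the joint probability in the state without the intermediate
  measurement.\<close>

lemma bind_measure_snd_measure_fst:
  assumes A: "A \<in> carrier_mat P P"
    and iso: "\<And>a. (\<Sum>l<P. (cmod (\<Sum>m<P. A $$ (l, m) * a m))\<^sup>2) = (\<Sum>m<P. (cmod (a m))\<^sup>2)"
    and dim: "dim_vec \<psi> = P * N" and norm: "(\<Sum>i<P * N. (cmod (\<psi> $ i))\<^sup>2) = 1"
  shows "bind_pmf (measure_snd P N \<psi>) (\<lambda>\<phi>. measure_fst P N (kron_mat A (1\<^sub>m N) *\<^sub>v \<phi>)) =
    measure_fst P N (kron_mat A (1\<^sub>m N) *\<^sub>v \<psi>)" (is "?L = ?R")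
proof (rule pmf_eqI)
  fix l
  let ?w = "prob_snd P N \<psi>"
  \<comment> \<open>Joint probability of \<open>l\<close> in the first and \<open>x\<close> in the
    second register.\<close>
  define q where "q x = (if l < P then (cmod (\<Sum>m<P. A $$ (l, m) * \<psi> $ (m * N + x)))\<^sup>2 else 0)" for x
  have out: "pmf (outcome_snd P N \<psi>) x = ?w x" for x by (rule pmf_outcome_snd[OF norm])
  have w_nonneg: "?w x \<ge> 0" for x by (simp add: prob_snd_def sum_nonneg)
  have step: "pmf (measure_fst P N (kron_mat A (1\<^sub>m N) *\<^sub>v collapse_snd P N \<psi> x)) l * ?w x = q x"
    if x: "x < N" for x
  proof (cases "?w x = 0")
    \<comment> \<open>A branch of weight 0 has no normalised collapse, so its measurement has no
      meaningful distribution. It is multiplied by 0, and \<open>q x = 0\<close> because all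
      amplitudes of the branch vanish.\<close>
    case True
    then have "\<psi> $ (m * N + x) = 0" if "m < P" for m
      using x that by (auto simp: prob_snd_def sum_nonneg_eq_0_iff)
    then show ?thesis using True by (simp add: q_def)
  next
    case False
    then have w: "?w x > 0" using w_nonneg[of x] by simp
    have c: "collapse_snd P N \<psi> x $ (m * N + y) =
        (if y = x then \<psi> $ (m * N + x) / complex_of_real (sqrt (?w x)) else 0)"
      if "m < P" "y < N" for m y
      using that product_index_less[OF that] by (simp add: collapse_snd_def)
    have sq: "(cmod (z / complex_of_real (sqrt (?w x))))\<^sup>2 = (cmod z)\<^sup>2 / ?w x" for z
      using w by (simp add: norm_divide power_divide)
    have "(\<Sum>i<P * N. (cmod (collapse_snd P N \<psi> x $ i))\<^sup>2)
        = (\<Sum>m<P. \<Sum>y<N. if y = x then (cmod (\<psi> $ (m * N + x)))\<^sup>2 / ?w x else 0)"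
      unfolding sum_product_index by (intro sum.cong refl) (simp add: c sq)
    also have "\<dots> = ?w x / ?w x" using x by (simp add: prob_snd_def flip: sum_divide_distrib)
    finally have norm': "(\<Sum>i<P * N. (cmod (collapse_snd P N \<psi> x $ i))\<^sup>2) = 1" using w by simp
    have "pmf (measure_fst P N (kron_mat A (1\<^sub>m N) *\<^sub>v collapse_snd P N \<psi> x)) l =
      (if l < P then \<Sum>y<N. (cmod (\<Sum>m<P. A $$ (l, m) * collapse_snd P N \<psi> x $ (m * N + y)))\<^sup>2 else 0)"
      by (rule pmf_measure_fst_kron_one[OF A iso _ norm']) (simp add: collapse_snd_def)
    also have "\<dots> = (if l < P then \<Sum>y<N. if y = x then
        (cmod ((\<Sum>m<P. A $$ (l, m) * \<psi> $ (m * N + x)) / complex_of_real (sqrt (?w x))))\<^sup>2 else 0 else 0)"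
      by (intro if_cong refl sum.cong) (auto simp: c sum_divide_distrib)
    also have "\<dots> = q x / ?w x" using x by (simp add: sq q_def)
    finally show ?thesis using w by simp
  qed
  have "pmf ?L l = (\<integral>x. pmf (measure_fst P N (kron_mat A (1\<^sub>m N) *\<^sub>v collapse_snd P N \<psi> x)) l
      \<partial>measure_pmf (outcome_snd P N \<psi>))"
    by (simp add: measure_snd_def bind_map_pmf pmf_bind)
  also have "\<dots> = (\<Sum>x<N. pmf (measure_fst P N (kron_mat A (1\<^sub>m N) *\<^sub>v collapse_snd P N \<psi> x)) l *
      pmf (outcome_snd P N \<psi>) x)"
    by (rule integral_measure_pmf_real)
      (auto simp: set_pmf_iff out prob_snd_def split: if_splits)
  also have "\<dots> = (\<Sum>x<N. q x)" by (simp add: out step)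
  also have "\<dots> = pmf ?R l"
    unfolding pmf_measure_fst_kron_one[OF A iso dim norm] by (simp add: q_def)
  finally show "pmf ?L l = pmf ?R l" .
qed

subsection \<open>The Grover rotation\<close>

lemma controlled_power_mult_vec_index:
  assumes "G \<in> carrier_mat N N" "dim_vec \<psi> = P * N" "m < P" "x < N"
  shows "(controlled_power P N G *\<^sub>v \<psi>) $ (m * N + x) = (\<Sum>y<N. (G ^\<^sub>m m) $$ (x, y) * \<psi> $ (m * N + y))"
proof -
  have "(controlled_power P N G *\<^sub>v \<psi>) $ (m * N + x)
      = (\<Sum>j<P * N. (if m = j div N then (G ^\<^sub>m (j div N)) $$ (x, j mod N) else 0) * \<psi> $ j)"
    using assms(2,4) product_index_less[OF assms(3,4)]
    by (simp add: controlled_power_def scalar_prod_def atLeast0LessThan cong: if_cong)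
  also have "\<dots> = (\<Sum>k<P. \<Sum>y<N. (if m = k then (G ^\<^sub>m k) $$ (x, y) else 0) * \<psi> $ (k * N + y))"
    unfolding sum_product_index by (intro sum.cong refl) simp
  also have "\<dots> = (\<Sum>k<P. if k = m then \<Sum>y<N. (G ^\<^sub>m m) $$ (x, y) * \<psi> $ (m * N + y) else 0)"
    by (intro sum.cong refl) auto
  finally show ?thesis using assms(3) by simp
qed

text \<open>The assumption \<open>t_less\<close> makes \<open>cos \<theta>\<close> positive, so that
  the plane contains a normalised vector of non-solutions. The sharper bound
  \<open>t \<le> N/2\<close> enters only in the theorem, as
  \<open>\<theta> \<le> pi/4\<close>.\<close>

locale grover_angle =
  fixes n :: nat and F :: "nat \<Rightarrow> nat" and \<theta> :: real and t :: nat
  assumes F_bool: "x < 2 ^ n \<Longrightarrow> F x = 0 \<or> F x = 1"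
    and t_eq: "t = card {x \<in> {..<2 ^ n}. F x = 1}"
    and t_less: "t < 2 ^ n"
    and theta_bounds: "0 \<le> \<theta>" "\<theta> \<le> pi / 2"
    and sin_theta: "sin \<theta> = sqrt (real t / 2 ^ n)"
begin

abbreviation "N \<equiv> 2 ^ n :: nat"

text \<open>If \<open>t = 0\<close>, the first branch is the junk value \<open>0\<close>, but then no index takes it.\<close>

definition amplitude :: "real \<Rightarrow> nat \<Rightarrow> real" where
  "amplitude \<phi> x = (if F x = 1 then sin \<phi> / sqrt (real t) else cos \<phi> / sqrt (real N - real t))"

lemma sum_by_value:
  fixes a b :: "'a :: comm_ring_1"
  shows "(\<Sum>x<N. if F x = 1 then a else b) = of_nat t * a + of_nat (N - t) * b"
proof -
  have "card ({..<N} - {x \<in> {..<N}. F x = 1}) = N - t"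
    by (subst card_Diff_subset) (auto simp: t_eq)
  moreover have "{..<N} \<inter> {x. F x = 1} = {x \<in> {..<N}. F x = 1}"
    "{..<N} \<inter> - {x. F x = 1} = {..<N} - {x \<in> {..<N}. F x = 1}" by auto
  ultimately show ?thesis by (simp add: sum.If_cases t_eq)
qed

lemma sqrt_t: "sqrt (real t) = sqrt (real N) * sin \<theta>"
  by (simp add: sin_theta real_sqrt_divide)

lemma sqrt_N_minus_t: "sqrt (real N - real t) = sqrt (real N) * cos \<theta>"
proof -
  have "(cos \<theta>)\<^sup>2 = 1 - real t / real N" by (simp add: cos_squared_eq sin_theta)
  then have "cos \<theta> = sqrt (1 - real t / real N)"
    using cos_ge_zero[of \<theta>] theta_bounds by (intro real_sqrt_unique[symmetric]) auto
  then show ?thesis by (simp add: real_sqrt_mult[symmetric] right_diff_distrib)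
qed

lemma cos_theta_pos: "cos \<theta> > 0"
proof -
  have "real t < real N" using t_less by (simp only: of_nat_less_iff)
  then have "sqrt (real N - real t) > 0" by simp
  then show ?thesis unfolding sqrt_N_minus_t by (simp add: zero_less_mult_iff)
qed

lemma sin_theta_pos: "x < N \<Longrightarrow> F x = 1 \<Longrightarrow> sin \<theta> > 0"
proof -
  assume "x < N" "F x = 1"
  then have "t > 0" by (auto simp: t_eq card_gt_0_iff)
  then show ?thesis by (simp add: sin_theta)
qed

text \<open>For \<open>t = 0\<close> every division by \<open>t\<close> yields 0. With
  \<open>\<theta> = 0\<close> the sines of its multiples vanish as well, so the norm identities
  below survive.\<close>

lemma theta_eq_0: "t = 0 \<Longrightarrow> \<theta> = 0"
  using sin_theta theta_bounds sin_gt_zero[of \<theta>] pi_gt_zero by (cases "\<theta> = 0") auto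

text \<open>The angle is restricted to multiples of \<open>\<theta>\<close> because of
  \<open>t = 0\<close>: for a general angle only the squared cosine would remain there.\<close>

lemma sum_amplitude_sq: "(\<Sum>x<N. (amplitude (k * \<theta>) x)\<^sup>2) = 1"
proof -
  have "(\<Sum>x<N. (amplitude (k * \<theta>) x)\<^sup>2) = (\<Sum>x<N. if F x = 1
      then (sin (k * \<theta>) / sqrt (real t))\<^sup>2 else (cos (k * \<theta>) / sqrt (real N - real t))\<^sup>2)"
    by (intro sum.cong refl) (simp add: amplitude_def)
  also have "\<dots> = real t * ((sin (k * \<theta>))\<^sup>2 / real t) + (cos (k * \<theta>))\<^sup>2"
    unfolding sum_by_value using t_less by (simp add: power_divide of_nat_diff)
  also have "\<dots> = 1" by (cases "t = 0") (simp_all add: theta_eq_0)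
  finally show ?thesis .
qed

text \<open>The signed amplitudes add up to \<open>sqrt N * cos (\<phi> + \<theta>)\<close>.
  Inversion about the mean then advances the angle by \<open>2 * \<theta>\<close> through the
  sum-to-product formulas for \<open>sin (\<phi> + 2 * \<theta>) - sin \<phi>\<close> and
  \<open>cos (\<phi> + 2 * \<theta>) + cos \<phi>\<close>.\<close>

lemma grover_amplitude:
  "grover_iteration n F *\<^sub>v Matrix.vec N (\<lambda>x. complex_of_real (amplitude \<phi> x)) =
    Matrix.vec N (\<lambda>x. complex_of_real (amplitude (\<phi> + 2 * \<theta>) x))"
proof (rule eq_vecI)
  fix x assume "x < dim_vec (Matrix.vec N (\<lambda>x. complex_of_real (amplitude (\<phi> + 2 * \<theta>) x)))"
  then have x: "x < N" by simp
  have sN: "sqrt (real N) > 0" "sqrt (real N) * sqrt (real N) = real N" by simp_all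
  have "(\<Sum>y<N. (- 1) ^ F y * amplitude \<phi> y)
      = (\<Sum>y<N. if F y = 1 then - (sin \<phi> / sqrt (real t)) else cos \<phi> / sqrt (real N - real t))"
  proof (intro sum.cong refl)
    fix y assume "y \<in> {..<N}"
    then show "(- 1) ^ F y * amplitude \<phi> y =
        (if F y = 1 then - (sin \<phi> / sqrt (real t)) else cos \<phi> / sqrt (real N - real t))"
      using F_bool[of y] by (auto simp: amplitude_def)
  qed
  also have "\<dots> = - (real t / sqrt (real t) * sin \<phi>) + (real N - real t) / sqrt (real N - real t)
      * cos \<phi>"
    unfolding sum_by_value using t_less by (simp add: of_nat_diff)
  also have "\<dots> = - (sqrt (real t) * sin \<phi>) + sqrt (real N - real t) * cos \<phi>"
    using t_less by (simp add: real_div_sqrt)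
  also have "\<dots> = sqrt (real N) * cos (\<phi> + \<theta>)"
    unfolding sqrt_t sqrt_N_minus_t by (simp add: cos_add algebra_simps)
  finally have S: "(\<Sum>y<N. (- 1) ^ F y * amplitude \<phi> y) = sqrt (real N) * cos (\<phi> + \<theta>)" .
  have "2 / real N * (sqrt (real N) * cos (\<phi> + \<theta>)) - (- 1) ^ F x * amplitude \<phi> x
      = amplitude (\<phi> + 2 * \<theta>) x"
  proof -
    have sin2: "sin (\<phi> + 2 * \<theta>) = sin \<phi> + 2 * sin \<theta> * cos (\<phi> + \<theta>)"
      using sin_add[of "\<phi> + \<theta>" \<theta>] sin_diff[of "\<phi> + \<theta>" \<theta>]
      by (simp add: add.commute)
    have cos2: "cos (\<phi> + 2 * \<theta>) = 2 * cos \<theta> * cos (\<phi> + \<theta>) - cos \<phi>"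
      using cos_add[of "\<phi> + \<theta>" \<theta>] cos_diff[of "\<phi> + \<theta>" \<theta>]
      by (simp add: add.commute)
    have c: "2 / real N * (sqrt (real N) * z) = 2 * z / sqrt (real N)" for z
      using sN by (simp add: field_simps)
    show ?thesis
    proof (cases "F x = 1")
      case True
      then have "sin \<theta> > 0" using sin_theta_pos[OF x] by simp
      then show ?thesis unfolding c amplitude_def sin2 sqrt_t using True sN(1)
        by (simp add: add_divide_distrib)
    next
      case False
      then have "F x = 0" using F_bool[OF x] by simp
      then show ?thesis unfolding c amplitude_def cos2 sqrt_N_minus_t using cos_theta_pos sN(1)
        by (simp add: diff_divide_distrib)
    qed
  qed
  then have "complex_of_real (2 / real N * (\<Sum>y<N. (- 1) ^ F y * amplitude \<phi> y) - (- 1) ^ F x * amplitude \<phi> x)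
      = complex_of_real (amplitude (\<phi> + 2 * \<theta>) x)" unfolding S by simp
  then show "(grover_iteration n F *\<^sub>v Matrix.vec N (\<lambda>x. complex_of_real (amplitude \<phi> x))) $ x
      = Matrix.vec N (\<lambda>x. complex_of_real (amplitude (\<phi> + 2 * \<theta>) x)) $ x"
    using x by (simp add: grover_iteration_mult_vec_index)
qed (use carrier_matD[OF grover_iteration_carrier] in simp)

lemma grover_power_amplitude:
  "(grover_iteration n F ^\<^sub>m m) *\<^sub>v Matrix.vec N (\<lambda>x. complex_of_real (amplitude \<phi> x)) =
    Matrix.vec N (\<lambda>x. complex_of_real (amplitude (\<phi> + 2 * real m * \<theta>) x))"
proof (induction m arbitrary: \<phi>)
  case (Suc m)
  have "(grover_iteration n F ^\<^sub>m Suc m) *\<^sub>v Matrix.vec N (\<lambda>x. complex_of_real (amplitude \<phi> x))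
    = (grover_iteration n F ^\<^sub>m m)
        *\<^sub>v (grover_iteration n F *\<^sub>v Matrix.vec N (\<lambda>x. complex_of_real (amplitude \<phi> x)))"
    unfolding pow_mat.simps by (rule assoc_mult_mat_vec[of _ N N _ N]) simp_all
  then show ?case unfolding grover_amplitude Suc by (simp add: algebra_simps)
qed (use carrier_matD[OF grover_iteration_carrier] in simp)

text \<open>The uniform start state is the point at angle \<open>\<theta>\<close>, so
  \<open>m\<close> iterations lead to the angle \<open>(2 * m + 1) * \<theta>\<close>.\<close>

lemma amplitude_theta: "x < N \<Longrightarrow> amplitude \<theta> x = 1 / sqrt (real N)"
  using cos_theta_pos sin_theta_pos[of x] unfolding amplitude_def sqrt_t sqrt_N_minus_t by auto

section \<open>The state before the Fourier transform and its measured distribution\<close>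

definition counted_state :: "nat \<Rightarrow> complex Matrix.vec" where
  "counted_state p = controlled_power (2 ^ p) N (grover_iteration n F) *\<^sub>v
    (kron_mat (walsh_hadamard p) (walsh_hadamard n) *\<^sub>v kron_vec (unit_vec (2 ^ p) 0) (unit_vec N 0))"

lemma dim_counted_state: "dim_vec (counted_state p) = 2 ^ p * N"
  by (simp add: counted_state_def controlled_power_def)

lemma counted_state_index:
  assumes "m < P" "x < N" "P = 2 ^ p"
  shows "counted_state p $ (m * N + x)
      = complex_of_real (amplitude ((2 * real m + 1) * \<theta>) x / sqrt (real P))"
proof -
  let ?G = "grover_iteration n F"
  let ?\<psi> = "kron_mat (walsh_hadamard p) (walsh_hadamard n) *\<^sub>v kron_vec (unit_vec P 0) (unit_vec N 0)"
  have dim: "dim_vec ?\<psi> = P * N" using assms by (simp add: kron_mat_def)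
  have psi: "?\<psi> $ (k * N + y) = complex_of_real (amplitude \<theta> y / sqrt (real P))"
      if "k < P" "y < N" for k y
  proof -
    have "?\<psi> $ (k * N + y) = (\<Sum>j<P. \<Sum>z<N. walsh_hadamard p $$ (k, j) * walsh_hadamard n $$ (y, z) *
        kron_vec (unit_vec P 0) (unit_vec N 0) $ (j * N + z))"
      using that assms by (intro kron_mat_mult_vec_index) (auto simp: kron_vec_def)
    also have "\<dots> = (\<Sum>j<P. \<Sum>z<N. if z = 0
        then (if j = 0 then walsh_hadamard p $$ (k, 0) * walsh_hadamard n $$ (y, 0) else 0) else 0)"
      using assms by (intro sum.cong refl) (auto simp: kron_vec_def product_index_less)
    also have "\<dots> = walsh_hadamard p $$ (k, 0) * walsh_hadamard n $$ (y, 0)"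
      using assms by simp
    finally show ?thesis using that assms by (simp add: walsh_hadamard_first amplitude_theta)
  qed
  have G: "?G ^\<^sub>m k \<in> carrier_mat N N" for k by simp
  have "(controlled_power P N ?G *\<^sub>v ?\<psi>) $ (m * N + x)
      = (\<Sum>y<N. (?G ^\<^sub>m m) $$ (x, y) * ?\<psi> $ (m * N + y))"
    by (rule controlled_power_mult_vec_index[OF grover_iteration_carrier dim assms(1,2)])
  also have "\<dots> = (\<Sum>y<N. (?G ^\<^sub>m m) $$ (x, y) * complex_of_real (amplitude \<theta> y))
      / complex_of_real (sqrt (real P))"
    unfolding sum_divide_distrib using psi[OF assms(1)] by (intro sum.cong refl) simp
  also have "\<dots> = ((?G ^\<^sub>m m) *\<^sub>v Matrix.vec N (\<lambda>x. complex_of_real (amplitude \<theta> x))) $ x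
      / complex_of_real (sqrt (real P))"
    unfolding mult_mat_vec_index_sum[OF G vec_carrier assms(2)] using assms(1) by simp
  also have "\<dots> = complex_of_real (amplitude ((2 * real m + 1) * \<theta>) x / sqrt (real P))"
    unfolding grover_power_amplitude using assms(2) by (simp add: algebra_simps)
  finally show ?thesis unfolding counted_state_def assms(3)[symmetric] .
qed

text \<open>The rotation has the eigenphases \<open>2 * \<theta>\<close> and
  \<open>- 2 * \<theta>\<close>. Passing from the sine and cosine sums \<open>A\<close>,
  \<open>B\<close> to \<open>B - \<i> * A\<close> and \<open>B + \<i> * A\<close> separates them
  into two geometric sums, and the parallelogram law recombines the squares.\<close>

lemma sum_fourier_amplitude_sq:
  fixes z :: "nat \<Rightarrow> complex"
  shows "(\<Sum>x<N. (cmod (\<Sum>m<P. cis (2 * y * real m)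
      * complex_of_real (amplitude ((2 * real m + 1) * \<theta>) x)))\<^sup>2)
    = ((cmod (dirichlet_sum P (y - \<theta>)))\<^sup>2 + (cmod (dirichlet_sum P (y + \<theta>)))\<^sup>2) / 2"
proof -
  define A where "A = (\<Sum>m<P. cis (2 * y * real m) * complex_of_real (sin ((2 * real m + 1) * \<theta>)))"
  define B where "B = (\<Sum>m<P. cis (2 * y * real m) * complex_of_real (cos ((2 * real m + 1) * \<theta>)))"
  have "(\<Sum>m<P. cis (2 * y * real m) * complex_of_real (amplitude ((2 * real m + 1) * \<theta>) x))
      = (if F x = 1 then A / complex_of_real (sqrt (real t))
          else B / complex_of_real (sqrt (real N - real t)))" for x
    by (simp add: amplitude_def A_def B_def sum_divide_distrib)
  then have "(\<Sum>x<N. (cmod (\<Sum>m<P. cis (2 * y * real m)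
      * complex_of_real (amplitude ((2 * real m + 1) * \<theta>) x)))\<^sup>2)
      = (\<Sum>x<N. if F x = 1 then (cmod A)\<^sup>2 / real t else (cmod B)\<^sup>2 / (real N - real t))"
    using t_less by (intro sum.cong refl) (simp add: norm_divide power_divide)
  also have "\<dots> = real t * ((cmod A)\<^sup>2 / real t) + (cmod B)\<^sup>2"
    unfolding sum_by_value using t_less by (simp add: of_nat_diff)
  \<comment> \<open>For \<open>t = 0\<close> the left side is 0 by the convention for division, and
    \<open>A\<close> vanishes because \<open>\<theta> = 0\<close>.\<close>
  also have "real t * ((cmod A)\<^sup>2 / real t) = (cmod A)\<^sup>2"
    by (cases "t = 0") (simp_all add: A_def theta_eq_0)
  also have "(cmod A)\<^sup>2 + (cmod B)\<^sup>2 = ((cmod (B - \<i> * A))\<^sup>2 + (cmod (B + \<i> * A))\<^sup>2) / 2"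
    unfolding cmod_power2 by (simp add: power2_eq_square algebra_simps)
  also have "B + \<i> * A = cis \<theta> * dirichlet_sum P (y + \<theta>)"
  proof -
    have "cis (2 * y * real m) * complex_of_real (cos a)
        + \<i> * (cis (2 * y * real m) * complex_of_real (sin a))
        = cis (2 * y * real m + a)" for m a
      by (simp add: complex_eq_iff cos_add sin_add)
    then have "B + \<i> * A = (\<Sum>m<P. cis (2 * y * real m + (2 * real m + 1) * \<theta>))"
      unfolding A_def B_def by (simp add: sum_distrib_left flip: sum.distrib)
    also have "\<dots> = (\<Sum>m<P. cis \<theta> * cis (2 * (y + \<theta>) * real m))"
      by (intro sum.cong refl) (simp add: cis_mult algebra_simps)
    finally show ?thesis by (simp add: dirichlet_sum_def sum_distrib_left)
  qed
  also have "B - \<i> * A = cis (- \<theta>) * dirichlet_sum P (y - \<theta>)"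
  proof -
    have "cis (2 * y * real m) * complex_of_real (cos a)
        - \<i> * (cis (2 * y * real m) * complex_of_real (sin a))
        = cis (2 * y * real m - a)" for m a
      by (simp add: complex_eq_iff cos_diff sin_diff)
    then have "B - \<i> * A = (\<Sum>m<P. cis (2 * y * real m - (2 * real m + 1) * \<theta>))"
      unfolding A_def B_def by (simp add: sum_distrib_left flip: sum_subtractf)
    also have "\<dots> = (\<Sum>m<P. cis (- \<theta>) * cis (2 * (y - \<theta>) * real m))"
      by (intro sum.cong refl) (simp add: cis_mult algebra_simps)
    finally show ?thesis by (simp add: dirichlet_sum_def sum_distrib_left)
  qed
  finally show ?thesis by (simp add: norm_mult)
qed

lemma norm_counted_state: "(\<Sum>i<2 ^ p * N. (cmod (counted_state p $ i))\<^sup>2) = 1"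
proof -
  have "(\<Sum>i<2 ^ p * N. (cmod (counted_state p $ i))\<^sup>2)
      = (\<Sum>m<2 ^ p. \<Sum>x<N. (amplitude ((2 * real m + 1) * \<theta>) x)\<^sup>2 / 2 ^ p)"
    unfolding sum_product_index
    by (intro sum.cong refl) (simp add: counted_state_index norm_divide power_divide)
  also have "\<dots> = 1" by (simp add: sum_amplitude_sq flip: sum_divide_distrib)
  finally show ?thesis .
qed

lemma pmf_measure_counted_state:
  assumes "l < P" "P = 2 ^ p"
  shows "pmf (measure_fst P N (kron_mat (qft P) (1\<^sub>m N) *\<^sub>v counted_state p)) l =
    ((cmod (dirichlet_sum P (pi / real P * real l - \<theta>)))\<^sup>2
      + (cmod (dirichlet_sum P (pi / real P * real l + \<theta>)))\<^sup>2) / (2 * (real P)\<^sup>2)"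
proof -
  let ?y = "pi / real P * real l"
  have sq: "complex_of_real (sqrt (real P)) * complex_of_real (sqrt (real P)) = of_nat P"
    by (simp flip: of_real_mult)
  have K: "(\<Sum>m<P. qft P $$ (l, m) * counted_state p $ (m * N + x))
      = (\<Sum>m<P. cis (2 * ?y * real m) * complex_of_real (amplitude ((2 * real m + 1) * \<theta>) x))
          / complex_of_real (real P)"
    if "x < N" for x
    unfolding sum_divide_distrib
  proof (intro sum.cong refl)
    fix m assume "m \<in> {..<P}"
    then show "qft P $$ (l, m) * counted_state p $ (m * N + x) =
      cis (2 * ?y * real m) * complex_of_real (amplitude ((2 * real m + 1) * \<theta>) x)
          / complex_of_real (real P)"
      using that assms(1) by (simp add: qft_index counted_state_index[OF _ that assms(2)] sq)
  qed
  have "pmf (measure_fst P N (kron_mat (qft P) (1\<^sub>m N) *\<^sub>v counted_state p)) l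
      = (\<Sum>x<N. (cmod (\<Sum>m<P. qft P $$ (l, m) * counted_state p $ (m * N + x)))\<^sup>2)"
    using assms pmf_measure_fst_kron_one[OF qft_carrier qft_parseval, of "counted_state p" P N l]
      dim_counted_state[of p] norm_counted_state[of p] by simp
  also have "\<dots> = (\<Sum>x<N. (cmod (\<Sum>m<P. cis (2 * ?y * real m) *
      complex_of_real (amplitude ((2 * real m + 1) * \<theta>) x)))\<^sup>2) / (real P)\<^sup>2"
    unfolding sum_divide_distrib
    by (intro sum.cong refl) (simp only: K lessThan_iff norm_divide power_divide norm_of_real power2_abs)
  finally show ?thesis unfolding sum_fourier_amplitude_sq by simp
qed

text \<open>The deferred measurement makes both values of \<open>meas\<close> agree, and the output
  becomes a function of a single measurement of the first register.\<close>

lemma quantum_count_eq: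
  assumes "P = 2 ^ p"
  shows "quantum_count meas n F p =
    map_pmf (\<lambda>f. real N * (sin (real (if real f > real P / 2 then P - f else f) * pi / real P))\<^sup>2)
      (measure_fst P N (kron_mat (qft P) (1\<^sub>m N) *\<^sub>v counted_state p))" (is "_ = map_pmf ?h ?M")
proof -
  have "quantum_count meas n F p =
      bind_pmf (bind_pmf (if meas then measure_snd P N (counted_state p) else
          return_pmf (counted_state p))
        (\<lambda>\<phi>. measure_fst P N (kron_mat (qft P) (1\<^sub>m N) *\<^sub>v \<phi>))) (\<lambda>f. return_pmf (?h f))"
    unfolding quantum_count_def Let_def bind_assoc_pmf counted_state_def assms ..
  also have "bind_pmf (if meas then measure_snd P N (counted_state p) else
      return_pmf (counted_state p))
      (\<lambda>\<phi>. measure_fst P N (kron_mat (qft P) (1\<^sub>m N) *\<^sub>v \<phi>)) = ?M"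
    using bind_measure_snd_measure_fst[OF qft_carrier qft_parseval, of "counted_state p" P N]
      dim_counted_state[of p] norm_counted_state[of p]
    by (simp add: assms bind_return_pmf)
  finally show ?thesis by (simp add: map_pmf_def)
qed

text \<open>The bound on squared sines with \<open>e = pi / P\<close>, scaled by \<open>N\<close>;
  the mixed term uses \<open>N * sin \<theta> = sqrt (t * N)\<close>.\<close>

lemma estimate_error_less:
  assumes "P > 0" "\<bar>y - \<theta>\<bar> \<le> pi / real P"
  shows "\<bar>real t - real N * (sin y)\<^sup>2\<bar> <
    2 * pi / real P * sqrt (real t * real N) + pi\<^sup>2 / (real P)\<^sup>2 * real N"
proof -
  have "sin \<theta> \<ge> 0" by (simp add: sin_theta)
  then have "\<bar>(sin \<theta>)\<^sup>2 - (sin (\<theta> + (y - \<theta>)))\<^sup>2\<bar> < 2 * (pi / real P) * sin \<theta> + (pi / real P)\<^sup>2"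
    using assms by (intro abs_sin_sq_diff_less) auto
  then have "real N * \<bar>(sin \<theta>)\<^sup>2 - (sin y)\<^sup>2\<bar> < real N * (2 * (pi / real P) * sin \<theta> + (pi / real P)\<^sup>2)"
    by (intro mult_strict_left_mono) auto
  moreover have "real N * \<bar>(sin \<theta>)\<^sup>2 - (sin y)\<^sup>2\<bar> = \<bar>real N * (sin \<theta>)\<^sup>2 - real N * (sin y)\<^sup>2\<bar>"
    by (simp add: abs_mult flip: right_diff_distrib)
  moreover have "real N * (sin \<theta>)\<^sup>2 = real t" by (simp add: sin_theta)
  moreover have "sqrt (real t * real N) = real N * sin \<theta>"
    unfolding real_sqrt_mult sqrt_t by simp
  ultimately show ?thesis by (simp add: power_divide algebra_simps)
qed

end

section \<open>Adding up the probabilities of the good outcomes\<close>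

theorem theorem5:
  fixes n p N P t :: nat and F :: "nat \<Rightarrow> nat" and meas :: bool
  assumes "N = 2 ^ n" and "P = 2 ^ p" and "P \<ge> 4"
    and "F \<in> {0..<N} \<rightarrow> {0, 1}"
    and "t = card {x \<in> {0..<N}. F x = 1}"
    and "real t \<le> real N / 2"
  shows "measure_pmf.prob (quantum_count meas n F p)
           {t'. \<bar>real t - t'\<bar> < 2 * pi / real P * sqrt (real t * real N)
                               + pi\<^sup>2 / (real P)\<^sup>2 * real N} \<ge> 8 / pi\<^sup>2"
proof -
  define \<theta> where "\<theta> = arcsin (sqrt (real t / real N))"
  have N: "real N > 0" and P: "P > 0" using assms by simp_all
  have r: "0 \<le> real t / real N" "real t / real N \<le> 1 / 2"
      using assms(6) N by (simp_all add: field_simps)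
  then have s: "sqrt (real t / real N) \<le> sqrt (1 / 2)" "0 \<le> sqrt (real t / real N)" by simp_all
  then have s_ge: "- 1 \<le> sqrt (real t / real N)" by linarith
  have half: "sqrt (1 / 2) = sin (pi / 4)"
      by (simp add: sin_45 real_sqrt_divide real_div_sqrt field_simps)
  have "real t / real N \<le> 1" using r by linarith
  then have s1: "sqrt (real t / real N) \<le> 1" by simp
  have "\<theta> \<le> arcsin (sin (pi / 4))" unfolding \<theta>_def
    using s(1) s_ge unfolding half by (intro arcsin_le_arcsin) auto
  then have \<theta>4: "\<theta> \<le> pi / 4" by (subst (asm) arcsin_sin) auto
  have "0 \<le> \<theta>" unfolding \<theta>_def using s s1 by (intro arcsin_nonneg) auto
  have "sin \<theta> = sqrt (real t / real N)" unfolding \<theta>_def using s_ge s1 by (intro sin_arcsin)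
  interpret grover_angle n F \<theta> t
  proof
    show "F x = 0 \<or> F x = 1" if "x < 2 ^ n" for x using assms(1,4) that by (auto simp: Pi_iff)
    show "t = card {x \<in> {..<2 ^ n}. F x = 1}" using assms(1,5) by (simp add: atLeast0LessThan)
    have "real t < real N" using assms(6) N by linarith
    then show "t < 2 ^ n" using assms(1) by (simp only: of_nat_less_iff)
    show "0 \<le> \<theta>" by fact
    show "\<theta> \<le> pi / 2" using \<theta>4 pi_gt_zero by linarith
    show "sin \<theta> = sqrt (real t / 2 ^ n)" using \<open>sin \<theta> = _\<close> assms(1) by simp
  qed
  define S where "S = {t'. \<bar>real t - t'\<bar> < 2 * pi / real P * sqrt (real t * real N)
                               + pi\<^sup>2 / (real P)\<^sup>2 * real N}"
  define h where "h f = real N * (sin (real (if real f > real P / 2 then P - f else f) * pi / real P))\<^sup>2" for f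
  define M where "M = measure_fst P N (kron_mat (qft P) (1\<^sub>m N) *\<^sub>v counted_state p)"
  define K where "K y = (cmod (dirichlet_sum P y))\<^sup>2" for y
  \<comment> \<open>Negation modulo \<open>P\<close>. The value at 0 is set separately because
    \<open>P - 0\<close> is not an outcome.\<close>
  define mirror where "mirror l = (if l = 0 then 0 else P - l)" for l
  define x where "x = real P * \<theta> / pi"
  define f where "f = nat \<lfloor>x\<rfloor>"
  have x: "0 \<le> x" "x \<le> real P / 4" unfolding x_def using \<theta>4 \<open>0 \<le> \<theta>\<close> P by (simp_all add: field_simps)
  have f: "real f \<le> x" "x < real f + 1" using x unfolding f_def by linarith+
  \<comment> \<open>From \<open>x \<le> P/4\<close> and \<open>P \<ge> 4\<close> it follows that
    \<open>f + 1 \<le> P/2\<close>, so both neighbours of \<open>x\<close> are outcomes, and so are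
    their mirror images.\<close>
  have fP: "f + 1 < P" "0 < P - (f + 1)" using f x assms(3) by linarith+
  have ang: "pi / real P * x = \<theta>" using P by (simp add: x_def)
  \<comment> \<open>Because \<open>sin (pi - a) = sin a\<close>, folding outcomes above
    \<open>P/2\<close> does not change the estimate, and \<open>h\<close> can be computed from the
    unfolded outcome.\<close>
  have sin_mirror: "sin (pi / real P * real (P - l)) = sin (pi / real P * real l)" if "l \<le> P" for l
    using that P by (simp add: of_nat_diff right_diff_distrib sin_diff)
  then have h: "h l = real N * (sin (pi / real P * real l))\<^sup>2" if "l \<le> P" for l
    using that by (simp add: h_def mult.commute)
  have h_mirror: "h (mirror l) = h l" if "l < P" for l
  proof (cases "l = 0")
    case False
    then show ?thesis using that h[of "P - l"] h[of l] sin_mirror[of l]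
        by (simp only: mirror_def) simp
  qed (simp add: mirror_def)
  \<comment> \<open>The kernel is even and has period pi, so the summand centred at
    \<open>- \<theta>\<close> takes at the mirror image the value of the other summand at
    \<open>l\<close>.\<close>
  have K_mirror: "K (pi / real P * real (mirror l) + \<theta>) = K (pi / real P * real l - \<theta>)"
      if "l < P" for l
  proof (cases "l = 0")
    case True
    then show ?thesis using dirichlet_sum_minus[of P \<theta>] by (simp add: K_def mirror_def)
  next
    case False
    have "pi / real P * real (mirror l) + \<theta> = - (pi / real P * real l - \<theta>) + pi"
      using False that P by (simp add: mirror_def of_nat_diff right_diff_distrib)
    then show ?thesis by (simp only: K_def dirichlet_sum_add_pi dirichlet_sum_minus complex_mod_cnj)
  qed
  have good: "h l \<in> S" if "l = f \<or> l = f + 1" for l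
  proof -
    have "\<bar>real l - x\<bar> \<le> 1" using that f by auto
    then have "pi / real P * \<bar>real l - x\<bar> \<le> pi / real P * 1" using P by (intro mult_left_mono) auto
    moreover have "pi / real P * real l - \<theta> = pi / real P * (real l - x)"
      unfolding right_diff_distrib ang ..
    then have "\<bar>pi / real P * real l - \<theta>\<bar> = pi / real P * \<bar>real l - x\<bar>"
      by (simp add: abs_mult)
    ultimately have "\<bar>pi / real P * real l - \<theta>\<bar> \<le> pi / real P" by simp
    from estimate_error_less[OF P this] show ?thesis
      using that fP assms(1) by (auto simp: S_def h)
  qed
  \<comment> \<open>The two kernels are summed separately over the same set \<open>G\<close>. An
    overlap between the neighbours and their mirror images, such as \<open>f = 0\<close> being its
    own mirror, therefore costs nothing.\<close>
  define G where "G = {l. l < P \<and> h l \<in> S}"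
  have G: "{f, f + 1} \<subseteq> G" "{mirror f, mirror (f + 1)} \<subseteq> G" "finite G"
    using good fP by (auto simp: G_def h_mirror) (auto simp: mirror_def)
  have pair: "8 / pi\<^sup>2 * (real P)\<^sup>2
      \<le> K (pi / real P * real f - \<theta>) + K (pi / real P * real (f + 1) - \<theta>)"
    using dirichlet_pair_ge[OF P f] unfolding K_def right_diff_distrib ang .
  also have "\<dots> = (\<Sum>l\<in>{f, f + 1}. K (pi / real P * real l - \<theta>))" by simp
  also have "\<dots> \<le> (\<Sum>l\<in>G. K (pi / real P * real l - \<theta>))"
    using G by (intro sum_mono2) (auto simp: K_def)
  finally have G1: "8 / pi\<^sup>2 * (real P)\<^sup>2 \<le> (\<Sum>l\<in>G. K (pi / real P * real l - \<theta>))" .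
  have "mirror f \<noteq> mirror (f + 1)" using fP by (auto simp: mirror_def)
  then have "K (pi / real P * real f - \<theta>) + K (pi / real P * real (f + 1) - \<theta>)
      = (\<Sum>l\<in>{mirror f, mirror (f + 1)}. K (pi / real P * real l + \<theta>))"
    using fP K_mirror[of f] K_mirror[of "f + 1"] by simp
  also have "\<dots> \<le> (\<Sum>l\<in>G. K (pi / real P * real l + \<theta>))"
    using G by (intro sum_mono2) (auto simp: K_def)
  finally have G2: "8 / pi\<^sup>2 * (real P)\<^sup>2 \<le> (\<Sum>l\<in>G. K (pi / real P * real l + \<theta>))"
      using pair by linarith
  have "8 / pi\<^sup>2 = (8 / pi\<^sup>2 * (real P)\<^sup>2 + 8 / pi\<^sup>2 * (real P)\<^sup>2) / (2 * (real P)\<^sup>2)"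
    using P by simp
  also have "\<dots> \<le> ((\<Sum>l\<in>G. K (pi / real P * real l - \<theta>)) + (\<Sum>l\<in>G. K (pi / real P * real l + \<theta>)))
      / (2 * (real P)\<^sup>2)"
    using G1 G2 by (intro divide_right_mono add_mono) auto
  also have "\<dots> = (\<Sum>l\<in>G. (K (pi / real P * real l - \<theta>) + K (pi / real P * real l + \<theta>))
      / (2 * (real P)\<^sup>2))"
    unfolding sum.distrib[symmetric] by (rule sum_divide_distrib)
  also have "\<dots> = (\<Sum>l\<in>G. pmf M l)"
    unfolding K_def M_def assms(1)
    by (intro sum.cong refl pmf_measure_counted_state[symmetric] assms(2)) (simp add: G_def)
  also have "\<dots> = measure_pmf.prob M G" using G by (simp add: measure_measure_pmf_finite)
  also have "\<dots> \<le> measure_pmf.prob M (h -` S)"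
    by (intro measure_pmf.finite_measure_mono) (auto simp: G_def)
  also have "\<dots> = measure_pmf.prob (quantum_count meas n F p) S"
    unfolding quantum_count_eq[OF assms(2)] M_def h_def[abs_def] assms(1) by simp
  finally show ?thesis unfolding S_def .
qed

end
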